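(* For every $p\in\big(1,\frac43\big)$ there exists a constant $K_p\in(0,\infty)$ such that for every $n,d\in\mathbb{N}$ with $d\in\{1,\ldots,n\}$ and every function $f:\{-1,1\}^n\to\mathbb{C}$ of degree at most $d$, we have $$\mathrm{Inf}^{(p)}f\leq K_p\,d^{\,2-\frac1\pi\arcsin\big(\frac{2\sqrt{p-1}}p\big)}\,\|f\|_{L_\infty(\{-1,1\}^n;\mathbb{C})}^p.$$
   Context: $\mathbb{N}=\{1,2,\ldots\}$. For $p\in[1,\infty)$, $\|f\|_{L_p(\{-1,1\}^n;\mathbb{C})}=\big(2^{-n}\sum_{\varepsilon\in\{-1,1\}^n}|f(\varepsilon)|^p\big)^{1/p}$, and $\|f\|_{L_\infty(\{-1,1\}^n;\mathbb{C})}=\max_\varepsilon|f(\varepsilon)|$. For $A\subseteq\{1,\ldots,n\}$, the Walsh function is $w_A(\varepsilon)=\prod_{i\in A}\varepsilon_i$. Every $f:\{-1,1\}^n\to\mathbb{C}$ has the expansion $f=\sum_{A}\widehat f(A)w_A$ with $\widehat f(A)=2^{-n}\sum_{\delta}f(\delta)w_A(\delta)$. A function $f$ has degree at most $d$ if $\widehat f(A)=0$ whenever $|A|>d$. The partial derivatives are $\partial_if(\varepsilon)=\frac{f(\varepsilon)-f(\varepsilon_1,\ldots,\varepsilon_{i-1},-\varepsilon_i,\varepsilon_{i+1},\ldots,\varepsilon_n)}2$, and $\mathrm{Inf}^{(p)}f=\sum_{i=1}^n\|\partial_if\|_{L_p(\{-1,1\}^n;\mathbb{C})}^p$. *)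

theory Defs
  imports "HOL-Analysis.Analysis"
begin

text \<open>
  The dimension is a natural number rather than a type, so that constants can be uniform in it.
  A function on the \<open>n\<close>-dimensional cube is represented by a total function on
  \<^typ>\<open>nat \<Rightarrow> real\<close>; only its values on \<open>cube n\<close> matter below.
\<close>

definition cube :: "nat \<Rightarrow> (nat \<Rightarrow> real) set" where
  "cube n = {1..n} \<rightarrow>\<^sub>E {-1, 1}"

definition Lp_norm :: "nat \<Rightarrow> real \<Rightarrow> ((nat \<Rightarrow> real) \<Rightarrow> complex) \<Rightarrow> real" where
  "Lp_norm n p f = ((\<Sum>\<epsilon>\<in>cube n. cmod (f \<epsilon>) powr p) / 2 ^ n) powr (1 / p)"

definition Linf_norm :: "nat \<Rightarrow> ((nat \<Rightarrow> real) \<Rightarrow> complex) \<Rightarrow> real" where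
  "Linf_norm n f = Max ((\<lambda>\<epsilon>. cmod (f \<epsilon>)) ` cube n)"

definition walsh :: "nat set \<Rightarrow> (nat \<Rightarrow> real) \<Rightarrow> real" where
  "walsh A \<epsilon> = (\<Prod>i\<in>A. \<epsilon> i)"

definition walsh_coeff :: "nat \<Rightarrow> ((nat \<Rightarrow> real) \<Rightarrow> complex) \<Rightarrow> nat set \<Rightarrow> complex" where
  "walsh_coeff n f A = (\<Sum>\<delta>\<in>cube n. f \<delta> * complex_of_real (walsh A \<delta>)) / 2 ^ n"

definition degree_at_most :: "nat \<Rightarrow> nat \<Rightarrow> ((nat \<Rightarrow> real) \<Rightarrow> complex) \<Rightarrow> bool" where
  "degree_at_most n d f \<longleftrightarrow> (\<forall>A. A \<subseteq> {1..n} \<and> card A > d \<longrightarrow> walsh_coeff n f A = 0)"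

definition cube_deriv :: "nat \<Rightarrow> ((nat \<Rightarrow> real) \<Rightarrow> complex) \<Rightarrow> (nat \<Rightarrow> real) \<Rightarrow> complex" where
  "cube_deriv i f \<epsilon> = (f \<epsilon> - f (\<epsilon>(i := - \<epsilon> i))) / 2"

definition Lp_influence :: "nat \<Rightarrow> real \<Rightarrow> ((nat \<Rightarrow> real) \<Rightarrow> complex) \<Rightarrow> real" where
  "Lp_influence n p f = (\<Sum>i=1..n. Lp_norm n p (cube_deriv i f) powr p)"

lemma finite_cube: "finite (cube n)"
  by (simp add: cube_def finite_PiE)

lemma card_cube: "card (cube n) = 2 ^ n"
  by (simp add: cube_def card_PiE numeral_2_eq_2)

lemma flip_in_cube:
  assumes "\<epsilon> \<in> cube n" "i \<in> {1..n}"
  shows "\<epsilon>(i := - \<epsilon> i) \<in> cube n"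
  using assms by (fastforce simp: cube_def PiE_def Pi_def extensional_def)

end

theory Submission
  imports Defs "HOL-Complex_Analysis.Complex_Analysis"
begin

text \<open>
  Let the noise operator of strength \<open>\<delta>\<close> multiply the Walsh coefficient at \<open>A\<close> by \<open>exp (- \<delta> * card A)\<close>.
  It commutes with the derivatives. The proof inserts noise, bounds the influence of the noisy function, and
  then shows that on degree at most \<open>d\<close> the noise can be removed again at bounded cost, provided that \<open>\<delta>\<close> is
  a suitable negative power of \<open>d\<close>.

  Noise makes gradients small. At a fixed point of the cube, the sum of the derivatives over any set of
  coordinates is the derivative of a polynomial of degree at most \<open>d\<close> in one variable, bounded on \<open>[-1, 1]\<close>
  by the maximum \<open>M\<close> of \<open>\<bar>f\<bar>\<close> and evaluated at \<open>exp (- \<delta>)\<close>, away from the endpoint. Bernstein's inequality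
  therefore bounds the \<open>\<ell>\<^sub>1\<close> norm of the gradient at every point by a multiple of \<open>d * M / sqrt \<delta>\<close>, whereas
  Parseval bounds the mean of its squared \<open>\<ell>\<^sub>2\<close> norm by \<open>d * M\<^sup>2\<close>. Interpolation yields an \<open>L\<^sub>p\<close> influence
  of order \<open>d * M powr p * \<delta> powr (- (2 - p) / 2)\<close> for the noisy function (\<open>noisy_influence\<close>).

  Noise can be undone. Let \<open>\<alpha> = arcsin (2 * sqrt (p - 1) / p)\<close>. A sharp two-point inequality
  (\<open>dual_power_sector\<close>) makes the rotated Laplacian accretive in \<open>L\<^sub>p\<close>, so that the heat flow is contractive
  for all complex times in the sector \<open>\<bar>arg z\<bar> \<le> \<alpha>\<close> (\<open>heat_contraction\<close>). On a function of degree at most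
  \<open>d\<close> the flow is an exponential sum in \<open>z\<close> with exponents at most \<open>d\<close>, and a Phragmen--Lindelof argument in
  the complementary sector of opening \<open>2 * (pi - \<alpha>)\<close> continues the bound from the sector to the time \<open>- \<delta>\<close>.
  The cost is a constant factor as long as \<open>d * \<delta> powr \<beta>\<close> stays bounded, for a fixed \<open>\<beta>\<close> with
  \<open>\<beta> * (pi - \<alpha>) < pi / 2\<close> (\<open>corner_growth\<close>, \<open>heat_extrapolation\<close>).

  The factor \<open>2 - p < 1\<close> gained by interpolation leaves room for this strict inequality: with
  \<open>\<beta> * (pi - \<alpha>) = (2 - p) * pi / 2\<close> and \<open>\<delta> = d powr (- 1 / \<beta>)\<close> the quantity
  \<open>d * \<delta> powr (- (2 - p) / 2)\<close> is exactly \<open>d powr (2 - \<alpha> / pi)\<close>.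
\<close>

section \<open>Polynomials bounded on an interval\<close>

text \<open>
  The Bernstein--Walsh growth bound in trigonometric form. With \<open>u = exp (\<i> z)\<close> one has
  \<open>cos z = (u + 1/u) / 2\<close>, so multiplying the polynomial by \<open>u ^ d\<close> clears the denominators and leaves
  a polynomial in \<open>u\<close>. On the unit circle \<open>(u + 1/u) / 2\<close> is real and lies in \<open>[-1, 1]\<close>, and the
  maximum principle carries the bound \<open>M\<close> to the disc, that is, to \<open>Im z \<ge> 0\<close>; the evenness of
  the cosine gives the other half-plane.
\<close>

lemma bernstein_cos:
  fixes c :: "nat \<Rightarrow> complex"
  assumes bd: "\<And>t::real. \<bar>t\<bar> \<le> 1 \<Longrightarrow> cmod (\<Sum>k\<le>d. c k * of_real t ^ k) \<le> M"
  shows "cmod (\<Sum>k\<le>d. c k * cos z ^ k) \<le> M * exp (real d * \<bar>Im z\<bar>)"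
proof -
  define S where "S u = (\<Sum>k\<le>d. c k * u ^ (d - k) * ((u\<^sup>2 + 1) / 2) ^ k)" for u :: complex
  have S: "S u = u ^ d * (\<Sum>k\<le>d. c k * ((u + inverse u) / 2) ^ k)" if "u \<noteq> 0" for u
  proof -
    have "c k * u ^ (d - k) * ((u\<^sup>2 + 1) / 2) ^ k = u ^ d * (c k * ((u + inverse u) / 2) ^ k)"
      if "k \<le> d" for k
    proof -
      have "(u\<^sup>2 + 1) / 2 = u * ((u + inverse u) / 2)"
        using \<open>u \<noteq> 0\<close> by (simp add: field_simps power2_eq_square)
      moreover have "u ^ d = u ^ (d - k) * u ^ k"
        using that by (simp flip: power_add)
      ultimately show ?thesis
        by (simp only: power_mult_distrib mult_ac)
    qed
    then show ?thesis
      unfolding S_def sum_distrib_left by (intro sum.cong) auto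
  qed
  have circle: "cmod (S u) \<le> M" if "cmod u = 1" for u
  proof -
    have "u \<noteq> 0" using that by auto
    have "inverse u = cnj u"
      using that complex_norm_square[of u] by (intro inverse_unique) simp
    then have "(u + inverse u) / 2 = of_real (Re u)"
      by (simp add: complex_eq_iff)
    moreover have "\<bar>Re u\<bar> \<le> 1"
      using abs_Re_le_cmod[of u] that by simp
    ultimately show ?thesis
      using bd[of "Re u"] S[OF \<open>u \<noteq> 0\<close>] that by (simp add: norm_mult norm_power)
  qed
  have disc: "cmod (S u) \<le> M" if "cmod u \<le> 1" for u
  proof (rule maximum_modulus_frontier[of S "cball 0 1"])
    show "S holomorphic_on interior (cball 0 1)"
      unfolding S_def by (intro holomorphic_intros) auto
    show "continuous_on (closure (cball 0 1)) S"
      unfolding S_def by (intro continuous_intros) auto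
  qed (use that circle in auto)
  have upper: "cmod (\<Sum>k\<le>d. c k * cos w ^ k) \<le> M * exp (real d * Im w)" if "Im w \<ge> 0" for w
  proof -
    define u where "u = exp (\<i> * w)"
    have u: "u \<noteq> 0" "cmod u = exp (- Im w)"
      by (auto simp: u_def)
    have cos: "cos w = (u + inverse u) / 2"
      by (simp add: u_def cos_exp_eq exp_minus)
    have "exp (- Im w) ^ d * cmod (\<Sum>k\<le>d. c k * cos w ^ k) = cmod (S u)"
      by (simp only: S[OF u(1)] cos norm_mult norm_power u(2))
    also have "\<dots> \<le> M"
      using that u by (intro disc) simp
    finally have "exp (- Im w) ^ d * cmod (\<Sum>k\<le>d. c k * cos w ^ k) \<le> M" .
    moreover have "exp (- Im w) ^ d = inverse (exp (real d * Im w))"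
      by (simp flip: exp_of_nat_mult exp_minus)
    ultimately show ?thesis
      by (simp add: field_simps)
  qed
  show ?thesis
    using upper[of z] upper[of "- z"] by (cases "Im z \<ge> 0") auto
qed

lemma DERIV_power_cos:
  fixes z :: complex
  shows "((\<lambda>w. cos w ^ k) has_field_derivative (of_nat k * cos z ^ (k - 1) * - sin z)) (at z)"
  by (rule derivative_eq_intros refl | simp)+

text \<open>
  Bernstein's inequality up to the factor \<open>exp 1\<close>: after the substitution \<open>t = cos \<theta>\<close> the polynomial
  is at most \<open>exp 1 * M\<close> within distance \<open>1 / d\<close> of \<open>\<theta>\<close>, so Cauchy's estimate on that disc bounds
  the derivative in \<open>\<theta>\<close>, which is \<open>- sqrt (1 - t\<^sup>2)\<close> times the derivative in \<open>t\<close>.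
\<close>

lemma bernstein_derivative:
  fixes c :: "nat \<Rightarrow> complex"
  assumes bd: "\<And>t::real. \<bar>t\<bar> \<le> 1 \<Longrightarrow> cmod (\<Sum>k\<le>d. c k * of_real t ^ k) \<le> M"
    and "d \<ge> 1" and t: "\<bar>t\<bar> < 1"
  shows "cmod (\<Sum>k\<le>d. of_nat k * c k * of_real t ^ (k - 1)) \<le> exp 1 * real d * M / sqrt (1 - t\<^sup>2)"
proof -
  define \<psi> where "\<psi> w = (\<Sum>k\<le>d. c k * cos w ^ k)" for w
  define \<theta> where "\<theta> = arccos t"
  have th: "cos \<theta> = t" "sin \<theta> = sqrt (1 - t\<^sup>2)"
    using t by (auto simp: \<theta>_def sin_arccos)
  have "M \<ge> 0"
    using order_trans[OF norm_ge_zero bd[of 0]] by simp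
  have "(\<psi> has_field_derivative
      (\<Sum>k\<le>d. c k * (of_nat k * cos (of_real \<theta>) ^ (k - 1) * - sin (of_real \<theta>)))) (at (of_real \<theta>))"
    unfolding \<psi>_def by (intro DERIV_sum DERIV_cmult DERIV_power_cos)
  moreover have "(\<Sum>k\<le>d. c k * (of_nat k * cos (of_real \<theta>) ^ (k - 1) * - sin (of_real \<theta>))) =
      - of_real (sqrt (1 - t\<^sup>2)) * (\<Sum>k\<le>d. of_nat k * c k * of_real t ^ (k - 1))"
    unfolding sum_distrib_left
    by (intro sum.cong) (simp_all only: cos_of_real sin_of_real th mult_minus_left mult_minus_right mult_ac)
  ultimately have D: "deriv \<psi> (of_real \<theta>) =
      - of_real (sqrt (1 - t\<^sup>2)) * (\<Sum>k\<le>d. of_nat k * c k * of_real t ^ (k - 1))"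
    by (metis DERIV_imp_deriv)
  have "cmod ((deriv ^^ 1) \<psi> (of_real \<theta>)) \<le> fact 1 * (M * exp 1) / (1 / real d) ^ 1"
  proof (rule Cauchy_inequality)
    fix x :: complex assume x: "cmod (of_real \<theta> - x) = 1 / real d"
    have "\<bar>Im x\<bar> \<le> 1 / real d"
      using abs_Im_le_cmod[of "of_real \<theta> - x"] x by simp
    then have "real d * \<bar>Im x\<bar> \<le> 1"
      using \<open>d \<ge> 1\<close> by (simp add: field_simps)
    then have "M * exp (real d * \<bar>Im x\<bar>) \<le> M * exp 1"
      using \<open>M \<ge> 0\<close> by (intro mult_left_mono) auto
    then show "cmod (\<psi> x) \<le> M * exp 1"
      using bernstein_cos[OF bd, of x] by (simp add: \<psi>_def)
  next
    show "\<psi> holomorphic_on ball (of_real \<theta>) (1 / real d)"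
      unfolding \<psi>_def by (intro holomorphic_intros)
    show "continuous_on (cball (of_real \<theta>) (1 / real d)) \<psi>"
      unfolding \<psi>_def by (intro continuous_intros)
  qed (use \<open>d \<ge> 1\<close> in auto)
  moreover have pos: "0 < 1 - t\<^sup>2"
    using t by (simp add: abs_square_less_1)
  ultimately show ?thesis
    by (simp add: D norm_mult field_simps)
qed

text \<open>
  The substitution \<open>x = t\<^sup>2\<close> maps \<open>[-1, 1]\<close> onto \<open>[0, 1]\<close> and turns the polynomial into one of degree
  \<open>2 * d\<close> in \<open>t\<close> without any recentring; \<open>bernstein_cos\<close> then applies at \<open>Arccos (csqrt w)\<close>.
  The endpoint \<open>0\<close> is left out of the hypothesis because it is the value at infinite time of an
  exponential sum in the application; continuity recovers it.
\<close>

lemma unit_interval_growth: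
  fixes c :: "nat \<Rightarrow> complex"
  assumes bd: "\<And>x::real. 0 < x \<Longrightarrow> x \<le> 1 \<Longrightarrow> cmod (\<Sum>k\<le>d. c k * of_real x ^ k) \<le> B"
  shows "cmod (\<Sum>k\<le>d. c k * w ^ k) \<le> B * exp (2 * real d * cmod (csqrt w))"
proof -
  define c' where "c' j = (if even j then c (j div 2) else 0)" for j
  have c': "(\<Sum>j\<le>2 * d. c' j * t ^ j) = (\<Sum>k\<le>d. c k * (t\<^sup>2) ^ k)" for t
  proof -
    have "(\<Sum>j\<le>2 * d. c' j * t ^ j) = (\<Sum>j\<in>(\<lambda>k. 2 * k) ` {..d}. c' j * t ^ j)"
    proof (rule sum.mono_neutral_right)
      show "\<forall>i\<in>{..2 * d} - (*) 2 ` {..d}. c' i * t ^ i = 0"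
        unfolding c'_def by (fastforce simp: dvd_def)
    qed auto
    also have "\<dots> = (\<Sum>k\<le>d. c k * (t\<^sup>2) ^ k)"
      by (subst sum.reindex) (auto simp: c'_def inj_on_def power_mult)
    finally show ?thesis .
  qed
  have cl: "cmod (\<Sum>k\<le>d. c k * of_real x ^ k) \<le> B" if "x \<in> {0..1}" for x :: real
  proof -
    have "continuous_on (closure {0<..<1}) (\<lambda>x::real. cmod (\<Sum>k\<le>d. c k * of_real x ^ k))"
      by (intro continuous_intros)
    then show ?thesis
      using continuous_le_on_closure[of "{0<..<1::real}"
          "\<lambda>x::real. cmod (\<Sum>k\<le>d. c k * of_real x ^ k)" x B] bd that
      by (simp add: closure_greaterThanLessThan)
  qed
  have "cmod (\<Sum>j\<le>2 * d. c' j * of_real t ^ j) \<le> B" if "\<bar>t\<bar> \<le> 1" for t :: real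
    using cl[of "t\<^sup>2"] that by (simp add: c' abs_square_le_1)
  from bernstein_cos[OF this, where z = "Arccos (csqrt w)"]
  have "cmod (\<Sum>k\<le>d. c k * w ^ k) \<le> B * exp (2 * real d * \<bar>Im (Arccos (csqrt w))\<bar>)"
    by (simp add: c')
  also have "\<dots> \<le> B * exp (2 * real d * cmod (csqrt w))"
  proof -
    have "B \<ge> 0"
      using order_trans[OF norm_ge_zero bd[of 1]] by simp
    moreover have "\<bar>Im (Arccos (csqrt w))\<bar> \<le> cmod (csqrt w)"
      by (rule Im_Arccos_bound)
    ultimately show ?thesis
      by (intro mult_left_mono iffD2[OF exp_le_cancel_iff]) auto
  qed
  finally show ?thesis .
qed

section \<open>Exponential sums near the corner of a sector\<close>

text \<open>
  A Phragmen--Lindelof estimate in the sector complementary to \<open>\<bar>arg z\<bar> \<le> \<alpha>\<close>, which has half-opening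
  \<open>pi - \<alpha>\<close>. There \<open>Re ((- z) powr \<beta>)\<close> is harmonic and at least \<open>cos (\<beta> * (pi - \<alpha>)) * \<bar>z\<bar> powr \<beta>\<close>,
  which is positive because \<open>\<beta> * (pi - \<alpha>) < pi / 2\<close>. Hence \<open>k / cos (\<beta> * (pi - \<alpha>))\<close> times it dominates
  \<open>ln \<bar>Q / B\<bar>\<close> on the unit arc, where the crude bound \<open>k\<close> is all that is known, and is nonnegative on
  the two rays, where \<open>\<bar>Q\<bar> \<le> B\<close>. By the maximum principle it dominates inside, in particular at \<open>- \<delta>\<close>.
  The coordinate \<open>z = - exp s\<close> turns the sector into a half-strip: no branch of the power is needed
  and the corner moves to \<open>Re s = - \<infinity>\<close>, where it is cut off at a cost \<open>\<epsilon>\<close>.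
\<close>

lemma corner_growth:
  fixes Q :: "complex \<Rightarrow> complex"
  assumes hol: "Q holomorphic_on UNIV"
    and ray: "\<And>r. 0 \<le> r \<Longrightarrow> r \<le> 1 \<Longrightarrow> cmod (Q (of_real r * cis \<alpha>)) \<le> B"
             "\<And>r. 0 \<le> r \<Longrightarrow> r \<le> 1 \<Longrightarrow> cmod (Q (of_real r * cis (- \<alpha>))) \<le> B"
    and circ: "\<And>z. cmod z \<le> 1 \<Longrightarrow> cmod (Q z) \<le> B * exp k"
    and "0 < \<beta>" "\<alpha> < pi" and angle: "\<beta> * (pi - \<alpha>) < pi / 2" and "0 < \<delta>" "\<delta> \<le> 1" "k \<ge> 0"
  shows "cmod (Q (- of_real \<delta>)) \<le> B * exp (k * \<delta> powr \<beta> / cos (\<beta> * (pi - \<alpha>)))"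
proof -
  define co where "co = cos (\<beta> * (pi - \<alpha>))"
  have "co > 0"
    unfolding co_def
  proof (rule cos_gt_zero_pi)
    have "0 < \<beta> * (pi - \<alpha>)"
      using \<open>0 < \<beta>\<close> \<open>\<alpha> < pi\<close> by simp
    then show "- (pi / 2) < \<beta> * (pi - \<alpha>)"
      using pi_gt_zero by linarith
  qed (rule angle)
  define \<Psi> where "\<Psi> s = Q (- exp s) * exp (- of_real (k / co) * exp (of_real \<beta> * s))" for s
  have norm_\<Psi>: "cmod (\<Psi> s) = cmod (Q (- exp s)) * exp (- (k / co) * (exp (\<beta> * Re s) * cos (\<beta> * Im s)))" for s
    by (simp add: \<Psi>_def norm_mult Re_exp)
  have Bnn: "B \<ge> 0"
    using order_trans[OF norm_ge_zero ray(1)[of 0]] by simp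
  have co_le: "co \<le> cos (\<beta> * y)" if "\<bar>y\<bar> \<le> pi - \<alpha>" for y
  proof -
    have "\<bar>\<beta> * y\<bar> \<le> \<beta> * (pi - \<alpha>)"
      using that \<open>0 < \<beta>\<close> by (simp add: abs_mult)
    then have "cos (\<beta> * (pi - \<alpha>)) \<le> cos \<bar>\<beta> * y\<bar>"
      using angle by (intro cos_monotone_0_pi_le) auto
    then show ?thesis
      by (simp add: co_def)
  qed
  have main: "cmod (\<Psi> (of_real (ln \<delta>))) \<le> B + \<epsilon>" if "\<epsilon> > 0" for \<epsilon>
  proof -
    have "isCont Q 0"
      using holomorphic_on_imp_continuous_on[OF hol] continuous_on_eq_continuous_at[OF open_UNIV] by blast
    then obtain \<eta> where \<eta>: "\<eta> > 0" "\<And>z. cmod z < \<eta> \<Longrightarrow> cmod (Q z - Q 0) < \<epsilon>"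
      using \<open>\<epsilon> > 0\<close> unfolding continuous_at_eps_delta by (auto simp: dist_norm)
    \<comment> \<open>The left edge lies so far out that \<open>Q\<close> differs there from \<open>Q 0\<close> by less than \<open>\<epsilon>\<close>, and to the left of \<open>ln \<delta>\<close>.\<close>
    define N where "N = min (ln (\<eta> / 2)) (ln \<delta>)"
    have "exp N < \<eta>"
    proof -
      have "exp N \<le> exp (ln (\<eta> / 2))" by (simp add: N_def)
      then show ?thesis using \<eta>(1) by simp
    qed
    define R where "R = cbox (Complex N (- (pi - \<alpha>))) (Complex 0 (pi - \<alpha>))"
    have inR: "z \<in> R \<longleftrightarrow> N \<le> Re z \<and> Re z \<le> 0 \<and> \<bar>Im z\<bar> \<le> pi - \<alpha>" for z
      by (auto simp: R_def in_cbox_complex_iff)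
    show ?thesis
    proof (rule maximum_modulus_frontier[of \<Psi> R])
      have "(\<lambda>s. Q (- exp s)) holomorphic_on UNIV"
        by (rule holomorphic_on_compose_gen[OF _ hol, unfolded o_def]) (auto intro!: holomorphic_intros)
      then have h: "\<Psi> holomorphic_on UNIV"
        unfolding \<Psi>_def by (intro holomorphic_intros)
      then show "\<Psi> holomorphic_on interior R"
        by (rule holomorphic_on_subset) auto
      show "continuous_on (closure R) \<Psi>"
        using h holomorphic_on_imp_continuous_on continuous_on_subset by blast
      show "bounded R"
        by (simp add: R_def)
      show "of_real (ln \<delta>) \<in> R"
        using \<open>0 < \<delta>\<close> \<open>\<delta> \<le> 1\<close> \<open>\<alpha> < pi\<close> by (simp add: inR N_def)
    next
      fix z assume z: "z \<in> frontier R"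
      have "z \<in> R"
        using z by (auto simp: frontier_def R_def)
      then have zR: "N \<le> Re z" "Re z \<le> 0" "\<bar>Im z\<bar> \<le> pi - \<alpha>"
        by (auto simp: inR)
      have cpos: "0 < cos (\<beta> * Im z)"
        using co_le[OF zR(3)] \<open>co > 0\<close> by linarith
      have "\<not> (N < Re z \<and> Re z < 0 \<and> - (pi - \<alpha>) < Im z \<and> Im z < pi - \<alpha>)"
        using z by (auto simp: frontier_def R_def in_box_complex_iff)
      then consider "Re z = N" | "Re z = 0" | "Im z = pi - \<alpha>" | "Im z = - (pi - \<alpha>)"
        using zR by linarith
      then show "cmod (\<Psi> z) \<le> B + \<epsilon>"
      proof cases
        case 1
        have "cmod (Q (- exp z)) \<le> B + \<epsilon>"
        proof -
          have "cmod (Q (- exp z) - Q 0) < \<epsilon>"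
            using \<eta>(2)[of "- exp z"] 1 \<open>exp N < \<eta>\<close> by simp
          moreover have "cmod (Q 0) \<le> B"
            using ray(1)[of 0] by simp
          ultimately show ?thesis
            using norm_triangle_sub[of "Q (- exp z)" "Q 0"] by linarith
        qed
        moreover have "exp (- (k / co) * (exp (\<beta> * Re z) * cos (\<beta> * Im z))) \<le> 1"
          using cpos \<open>co > 0\<close> \<open>k \<ge> 0\<close> by (simp add: zero_le_mult_iff)
        ultimately show ?thesis
          unfolding norm_\<Psi> by (smt (verit) mult_left_le norm_ge_zero)
      next
        case 2
        have "cmod (Q (- exp z)) \<le> B * exp k"
          using 2 by (intro circ) simp
        moreover have "exp (- (k / co) * (exp (\<beta> * Re z) * cos (\<beta> * Im z))) \<le> exp (- k)"
        proof -
          have "k * co \<le> k * cos (\<beta> * Im z)"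
            using co_le[OF zR(3)] \<open>k \<ge> 0\<close> by (intro mult_left_mono)
          then show ?thesis
            using 2 \<open>co > 0\<close> by (simp add: field_simps)
        qed
        ultimately have "cmod (\<Psi> z) \<le> B * exp k * exp (- k)"
          unfolding norm_\<Psi> by (intro mult_mono) (auto simp: Bnn)
        then show ?thesis
          using \<open>\<epsilon> > 0\<close> by (simp add: exp_minus field_simps)
      next
        case 3
        have "- exp z = of_real (exp (Re z)) * cis (- \<alpha>)"
          using 3 by (simp add: complex_eq_iff Re_exp Im_exp cos_diff sin_diff)
        then have "cmod (Q (- exp z)) \<le> B"
          using ray(2)[of "exp (Re z)"] zR by simp
        moreover have "exp (- (k / co) * (exp (\<beta> * Re z) * cos (\<beta> * Im z))) \<le> 1"
          using cpos \<open>co > 0\<close> \<open>k \<ge> 0\<close> by (simp add: zero_le_mult_iff)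
        ultimately show ?thesis
          unfolding norm_\<Psi> using \<open>\<epsilon> > 0\<close> by (smt (verit) mult_left_le norm_ge_zero)
      next
        case 4
        have "- exp z = of_real (exp (Re z)) * cis \<alpha>"
          using 4 by (simp add: complex_eq_iff Re_exp Im_exp cos_diff sin_diff)
        then have "cmod (Q (- exp z)) \<le> B"
          using ray(1)[of "exp (Re z)"] zR by simp
        moreover have "exp (- (k / co) * (exp (\<beta> * Re z) * cos (\<beta> * Im z))) \<le> 1"
          using cpos \<open>co > 0\<close> \<open>k \<ge> 0\<close> by (simp add: zero_le_mult_iff)
        ultimately show ?thesis
          unfolding norm_\<Psi> using \<open>\<epsilon> > 0\<close> by (smt (verit) mult_left_le norm_ge_zero)
      qed
    qed
  qed
  have "cmod (\<Psi> (of_real (ln \<delta>))) \<le> B"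
    using main by (rule field_le_epsilon)
  moreover have "cmod (\<Psi> (of_real (ln \<delta>))) = cmod (Q (- of_real \<delta>)) * exp (- (k * \<delta> powr \<beta> / co))"
    using \<open>\<delta> > 0\<close> by (simp add: norm_\<Psi> powr_def exp_of_real)
  ultimately show ?thesis
    by (simp add: co_def exp_minus field_simps)
qed

text \<open>
  An exponential sum with exponents \<open>0, \<dots>, d\<close> that is bounded on a sector of half-opening \<open>\<alpha>\<close> can be
  continued a distance \<open>\<delta>\<close> beyond the corner. The crude bound required by \<open>corner_growth\<close> comes for free:
  in the variable \<open>exp (- z)\<close> the sum is a polynomial of degree at most \<open>d\<close>, bounded on \<open>(0, 1]\<close> because the
  positive axis belongs to the sector.
\<close>

lemma exponential_sum_extrapolation:
  fixes c :: "nat \<Rightarrow> complex"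
  assumes bd: "\<And>t \<theta>. 0 \<le> t \<Longrightarrow> \<bar>\<theta>\<bar> \<le> \<alpha> \<Longrightarrow>
      cmod (\<Sum>k\<le>d. c k * exp (- (of_real t * cis \<theta>) * of_nat k)) \<le> B"
    and "0 \<le> \<alpha>" "\<alpha> < pi" "0 < \<beta>" "\<beta> * (pi - \<alpha>) < pi / 2" "0 < \<delta>" "\<delta> \<le> 1"
  shows "cmod (\<Sum>k\<le>d. c k * exp (of_real \<delta> * of_nat k))
    \<le> B * exp (4 * real d * \<delta> powr \<beta> / cos (\<beta> * (pi - \<alpha>)))"
proof -
  define Q where "Q z = (\<Sum>k\<le>d. c k * exp (- z * of_nat k))" for z
  have Q: "Q z = (\<Sum>k\<le>d. c k * exp (- z) ^ k)" for z
    unfolding Q_def by (intro sum.cong) (auto simp: mult.commute simp flip: exp_of_nat_mult)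
  have Bnn: "B \<ge> 0"
    using order_trans[OF norm_ge_zero bd[of 0 0]] \<open>0 \<le> \<alpha>\<close> by simp
  have "cmod (Q (- of_real \<delta>)) \<le> B * exp (4 * real d * \<delta> powr \<beta> / cos (\<beta> * (pi - \<alpha>)))"
  proof (rule corner_growth)
    show "Q holomorphic_on UNIV"
      unfolding Q_def by (intro holomorphic_intros)
  next
    fix z :: complex assume "cmod z \<le> 1"
    have "cmod (Q z) \<le> B * exp (2 * real d * cmod (csqrt (exp (- z))))"
      unfolding Q
    proof (rule unit_interval_growth)
      fix x :: real assume "0 < x" "x \<le> 1"
      then show "cmod (\<Sum>k\<le>d. c k * of_real x ^ k) \<le> B"
        using bd[of "- ln x" 0] \<open>0 \<le> \<alpha>\<close> Q[of "- of_real (ln x)"]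
        by (simp add: Q_def exp_of_real)
    qed
    also have "\<dots> \<le> B * exp (4 * real d)"
    proof -
      have "exp (- Re z) \<le> exp 1"
        using abs_Re_le_cmod[of z] \<open>cmod z \<le> 1\<close> by simp
      also have "\<dots> \<le> 2\<^sup>2"
        using exp_le by simp
      finally have "cmod (csqrt (exp (- z))) \<le> 2"
        by (simp add: norm_csqrt real_le_lsqrt)
      then have "real d * cmod (csqrt (exp (- z))) \<le> real d * 2"
        by (intro mult_left_mono) auto
      then show ?thesis
        using Bnn by (intro mult_left_mono) auto
    qed
    finally show "cmod (Q z) \<le> B * exp (4 * real d)" .
  qed (use assms in \<open>auto simp: Q_def\<close>)
  then show ?thesis
    by (simp add: Q_def)
qed

section \<open>The numerical sector of the duality map\<close>

text \<open>
  The duality map of \<open>L\<^sub>p\<close>: pairing \<open>a\<close> with its image gives \<open>\<bar>a\<bar> powr p\<close>. At \<open>a = 0\<close> the factor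
  \<open>0 powr (p - 2)\<close> is \<open>0\<close>, so the map vanishes there.
\<close>

definition dual_power :: "real \<Rightarrow> complex \<Rightarrow> complex" where
  "dual_power p a = of_real (cmod a powr (p - 2)) * a"

lemma sinh_scaling:
  fixes p q u :: real
  assumes "0 \<le> q" "q \<le> p" "0 \<le> u"
  shows "p * sinh (q * u) \<le> q * sinh (p * u)"
proof -
  have "(\<lambda>u. q * sinh (p * u) - p * sinh (q * u)) 0 \<le> (\<lambda>u. q * sinh (p * u) - p * sinh (q * u)) u"
  proof (rule DERIV_nonneg_imp_nondecreasing[OF \<open>0 \<le> u\<close>])
    fix v :: real assume v: "0 \<le> v" "v \<le> u"
    have "cosh (q * v) \<le> cosh (p * v)"
      using assms v by (subst cosh_real_nonneg_le_iff) (auto intro: mult_right_mono)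
    then have "0 \<le> p * q * (cosh (p * v) - cosh (q * v))"
      using assms by (intro mult_nonneg_nonneg) auto
    moreover have "((\<lambda>u. q * sinh (p * u) - p * sinh (q * u)) has_real_derivative
        p * q * (cosh (p * v) - cosh (q * v))) (at v)"
      by (auto intro!: derivative_eq_intros simp: algebra_simps)
    ultimately show "\<exists>D. ((\<lambda>u. q * sinh (p * u) - p * sinh (q * u)) has_real_derivative D) (at v) \<and> 0 \<le> D"
      by blast
  qed
  then show ?thesis by simp
qed

text \<open>
  By the addition formulas the right-hand product is \<open>(sinh (p * u))\<^sup>2 - (sinh ((2 - p) * u))\<^sup>2\<close>. Since
  \<open>p\<^sup>2 - (2 - p)\<^sup>2 = 4 * (p - 1)\<close>, the claim says that \<open>\<bar>sinh (c * u)\<bar> / c\<close> is at least as large at \<open>c = p\<close>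
  as at \<open>c = 2 - p\<close>, which is \<open>sinh_scaling\<close>.
\<close>

lemma sinh_product_bound:
  fixes p u :: real
  assumes "1 < p" "p < 2"
  shows "4 * (p - 1) * (sinh ((2 - p) * u))\<^sup>2 \<le> (2 - p)\<^sup>2 * (sinh (2 * u) * sinh (2 * (p - 1) * u))"
proof -
  have prod: "sinh (2 * u) * sinh (2 * (p - 1) * u) = (sinh (p * u))\<^sup>2 - (sinh ((2 - p) * u))\<^sup>2"
  proof -
    have "2 * u = p * u + (2 - p) * u" "2 * (p - 1) * u = p * u - (2 - p) * u"
      by (auto simp: algebra_simps)
    then have "sinh (2 * u) * sinh (2 * (p - 1) * u) =
        (sinh (p * u))\<^sup>2 * (cosh ((2 - p) * u))\<^sup>2 - (cosh (p * u))\<^sup>2 * (sinh ((2 - p) * u))\<^sup>2"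
      by (simp only: sinh_add sinh_diff) (simp add: power2_eq_square algebra_simps)
    then show ?thesis
      by (simp add: cosh_square_eq algebra_simps)
  qed
  have "p * sinh ((2 - p) * \<bar>u\<bar>) \<le> (2 - p) * sinh (p * \<bar>u\<bar>)"
    using assms by (intro sinh_scaling) auto
  then have "(p * sinh ((2 - p) * \<bar>u\<bar>))\<^sup>2 \<le> ((2 - p) * sinh (p * \<bar>u\<bar>))\<^sup>2"
    using assms by (intro power_mono) auto
  moreover have "(sinh (c * \<bar>u\<bar>))\<^sup>2 = (sinh (c * u))\<^sup>2" for c
    by (cases "u \<ge> 0") auto
  ultimately have "p\<^sup>2 * (sinh ((2 - p) * u))\<^sup>2 \<le> (2 - p)\<^sup>2 * (sinh (p * u))\<^sup>2"
    by (simp add: power_mult_distrib)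
  moreover have "(2 - p)\<^sup>2 * (X - Y) - 4 * (p - 1) * Y = (2 - p)\<^sup>2 * X - p\<^sup>2 * Y" for X Y :: real
    by (simp add: power2_eq_square algebra_simps)
  ultimately show ?thesis
    unfolding prod by (smt (verit))
qed

text \<open>
  Both sides are homogeneous of degree \<open>2 * p\<close> in \<open>(r, s)\<close>, and the second factor on the right equals
  \<open>(r\<^sup>2 - s\<^sup>2) * ((r * \<tau>)\<^sup>2 - (s * \<sigma>)\<^sup>2)\<close>. In terms of \<open>u = ln (r / s) / 2\<close> every difference is a
  hyperbolic sine, and the inequality becomes \<open>sinh_product_bound\<close>.
\<close>

lemma two_point_moduli_bound:
  fixes p r s :: real
  assumes "1 < p" "p < 2" "r > 0" "s > 0"
  defines "\<sigma> \<equiv> s powr (p - 2)" and "\<tau> \<equiv> r powr (p - 2)"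
  shows "4 * (p - 1) * ((r * s)\<^sup>2 * (\<sigma> - \<tau>)\<^sup>2)
    \<le> (2 - p)\<^sup>2 * ((r\<^sup>2 * \<tau> + s\<^sup>2 * \<sigma>)\<^sup>2 - (r * s)\<^sup>2 * (\<sigma> + \<tau>)\<^sup>2)"
proof -
  define x where "x = ln r"
  define y where "y = ln s"
  define u where "u = (x - y) / 2"
  define w where "w = (x + y) / 2"
  have x: "x = w + u" "y = w - u"
    by (auto simp: u_def w_def field_simps)
  have rs: "r = exp (w + u)" "s = exp (w - u)"
    using assms by (auto simp flip: x simp: x_def y_def)
  have st: "\<sigma> = exp ((p - 2) * (w - u))" "\<tau> = exp ((p - 2) * (w + u))"
    by (auto simp: \<sigma>_def \<tau>_def rs powr_def)
  have 1: "r * s * (\<sigma> - \<tau>) = 2 * exp (p * w) * sinh ((2 - p) * u)"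
    by (simp add: rs st sinh_field_def algebra_simps flip: exp_add)
  have 2: "r\<^sup>2 - s\<^sup>2 = 2 * exp (2 * w) * sinh (2 * u)"
    by (simp add: rs sinh_field_def power2_eq_square algebra_simps flip: exp_add)
  have 3: "(r * \<tau>)\<^sup>2 - (s * \<sigma>)\<^sup>2 = 2 * exp (2 * (p - 1) * w) * sinh (2 * (p - 1) * u)"
    by (simp add: rs st sinh_field_def power2_eq_square algebra_simps flip: exp_add)
  have "(r\<^sup>2 * \<tau> + s\<^sup>2 * \<sigma>)\<^sup>2 - (r * s)\<^sup>2 * (\<sigma> + \<tau>)\<^sup>2 = (r\<^sup>2 - s\<^sup>2) * ((r * \<tau>)\<^sup>2 - (s * \<sigma>)\<^sup>2)"
    by (simp add: power2_eq_square algebra_simps)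
  also have "\<dots> = 4 * exp (2 * p * w) * (sinh (2 * u) * sinh (2 * (p - 1) * u))"
    unfolding 2 3 by (simp add: algebra_simps flip: exp_add)
  finally have R: "(r\<^sup>2 * \<tau> + s\<^sup>2 * \<sigma>)\<^sup>2 - (r * s)\<^sup>2 * (\<sigma> + \<tau>)\<^sup>2 = \<dots>" .
  have L: "(r * s)\<^sup>2 * (\<sigma> - \<tau>)\<^sup>2 = 4 * exp (2 * p * w) * (sinh ((2 - p) * u))\<^sup>2"
    unfolding power_mult_distrib[symmetric] 1
    by (simp add: power_mult_distrib power2_eq_square algebra_simps flip: exp_add)
  show ?thesis
    using mult_left_mono[OF sinh_product_bound[OF assms(1,2), of u], of "4 * exp (2 * p * w)"]
    unfolding L R by (simp add: mult_ac)
qed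

text \<open>
  With \<open>v\<^sup>2 = N - u\<^sup>2\<close> the difference of the two sides is a quadratic polynomial in \<open>u\<close>; the hypothesis
  makes its discriminant nonpositive. In the application \<open>u\<close> and \<open>v\<close> are the real and imaginary parts of
  \<open>a * cnj b\<close>, so this step eliminates the angle between \<open>a\<close> and \<open>b\<close>.
\<close>

lemma quadratic_form_bound:
  fixes C P \<Sigma> D N u v :: real
  assumes "N * D\<^sup>2 \<le> C * (P\<^sup>2 - N * \<Sigma>\<^sup>2)" "C > 0" "u\<^sup>2 + v\<^sup>2 = N"
  shows "v\<^sup>2 * D\<^sup>2 \<le> C * (P - u * \<Sigma>)\<^sup>2"
proof (cases "D = 0")
  case False
  define E where "E = C * \<Sigma>\<^sup>2 + D\<^sup>2"
  have "E > 0"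
    using False \<open>C > 0\<close> by (simp add: E_def add_nonneg_pos)
  have v: "v\<^sup>2 = N - u\<^sup>2"
    using assms by simp
  have "E * (C * (P - u * \<Sigma>)\<^sup>2 - v\<^sup>2 * D\<^sup>2) =
      (E * u - C * P * \<Sigma>)\<^sup>2 + D\<^sup>2 * (C * (P\<^sup>2 - N * \<Sigma>\<^sup>2) - N * D\<^sup>2)"
    unfolding v E_def by (simp add: power2_eq_square algebra_simps)
  moreover have "\<dots> \<ge> 0"
    using assms by (intro add_nonneg_nonneg mult_nonneg_nonneg) auto
  ultimately have "0 \<le> E * (C * (P - u * \<Sigma>)\<^sup>2 - v\<^sup>2 * D\<^sup>2)"
    by simp
  then show ?thesis
    using \<open>E > 0\<close> by (simp add: zero_le_mult_iff)
qed (use assms in auto)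

text \<open>
  The Liskevich--Perelmuter inequality with its sharp constant: the numbers \<open>S\<close> fill at most the sector
  around the positive axis whose half-opening \<open>\<gamma>\<close> satisfies \<open>tan \<gamma> = (2 - p) / (2 * sqrt (p - 1))\<close>.
  So rotations by at most the complementary angle \<open>pi / 2 - \<gamma>\<close> keep \<open>S\<close> in the right half-plane.
\<close>

lemma dual_power_sector:
  fixes a b :: complex
  assumes p: "1 < p" "p < 2"
  defines "S \<equiv> (a - b) * cnj (dual_power p a - dual_power p b)"
  shows "0 \<le> Re S" and "2 * sqrt (p - 1) * \<bar>Im S\<bar> \<le> (2 - p) * Re S"
proof -
  have "0 \<le> Re S \<and> 2 * sqrt (p - 1) * \<bar>Im S\<bar> \<le> (2 - p) * Re S"
  proof (cases "a = 0 \<or> b = 0")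
    case True
    have "Re (z * cnj (dual_power p z)) \<ge> 0 \<and> Im (z * cnj (dual_power p z)) = 0" for z
      by (simp add: dual_power_def) (simp add: algebra_simps add_nonneg_nonneg flip: mult.assoc)
    from this[of a] this[of b] True show ?thesis
      using p by (auto simp: S_def dual_power_def)
  next
    case False
    define r where "r = cmod a"
    define s where "s = cmod b"
    define \<sigma> where "\<sigma> = s powr (p - 2)"
    define \<tau> where "\<tau> = r powr (p - 2)"
    define u where "u = Re (a * cnj b)"
    define v where "v = Im (a * cnj b)"
    define P where "P = r\<^sup>2 * \<tau> + s\<^sup>2 * \<sigma>"
    have rs: "r > 0" "s > 0"
      using False by (auto simp: r_def s_def)
    have st: "\<sigma> > 0" "\<tau> > 0"
      using rs by (auto simp: \<sigma>_def \<tau>_def)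
    have r2: "r\<^sup>2 = (Re a)\<^sup>2 + (Im a)\<^sup>2" and s2: "s\<^sup>2 = (Re b)\<^sup>2 + (Im b)\<^sup>2"
      by (simp_all add: r_def s_def cmod_power2)
    have uv: "u\<^sup>2 + v\<^sup>2 = (r * s)\<^sup>2"
      unfolding power_mult_distrib r2 s2 u_def v_def
      by (simp add: power2_eq_square algebra_simps)
    have ReS: "Re S = P - u * (\<sigma> + \<tau>)" and ImS: "Im S = v * (\<tau> - \<sigma>)"
      unfolding P_def r2 s2
      by (simp_all add: S_def dual_power_def u_def v_def \<sigma>_def \<tau>_def flip: r_def s_def)
         (simp_all add: power2_eq_square algebra_simps)
    have K: "4 * (p - 1) * ((r * s)\<^sup>2 * (\<sigma> - \<tau>)\<^sup>2) \<le> (2 - p)\<^sup>2 * (P\<^sup>2 - (r * s)\<^sup>2 * (\<sigma> + \<tau>)\<^sup>2)"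
      unfolding P_def \<sigma>_def \<tau>_def using two_point_moduli_bound[OF p rs] .
    have "v\<^sup>2 * (\<sigma> - \<tau>)\<^sup>2 \<le> (2 - p)\<^sup>2 / (4 * (p - 1)) * (P - u * (\<sigma> + \<tau>))\<^sup>2"
      using K p by (intro quadratic_form_bound[OF _ _ uv]) (auto simp: field_simps)
    then have "4 * (p - 1) * (v\<^sup>2 * (\<sigma> - \<tau>)\<^sup>2) \<le> (2 - p)\<^sup>2 * (P - u * (\<sigma> + \<tau>))\<^sup>2"
      using p by (simp add: field_simps)
    also have "4 * (p - 1) * (v\<^sup>2 * (\<sigma> - \<tau>)\<^sup>2) = (2 * sqrt (p - 1) * \<bar>Im S\<bar>)\<^sup>2"
      using p by (simp add: ImS power_mult_distrib abs_mult power2_commute)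
    finally have sq: "(2 * sqrt (p - 1) * \<bar>Im S\<bar>)\<^sup>2 \<le> ((2 - p) * Re S)\<^sup>2"
      by (simp add: ReS power_mult_distrib)
    have "P - u * (\<sigma> + \<tau>) \<ge> 0"
    proof -
      have "0 \<le> (2 - p)\<^sup>2 * (P\<^sup>2 - (r * s)\<^sup>2 * (\<sigma> + \<tau>)\<^sup>2)"
        using K p by (meson order_trans mult_nonneg_nonneg zero_le_power2 diff_ge_0_iff_ge less_imp_le zero_le_numeral)
      then have "((r * s) * (\<sigma> + \<tau>))\<^sup>2 \<le> P\<^sup>2"
        using p by (simp add: zero_le_mult_iff power_mult_distrib)
      then have "r * s * (\<sigma> + \<tau>) \<le> P"
        by (rule power2_le_imp_le) (use st in \<open>auto simp: P_def\<close>)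
      moreover have "u \<le> r * s"
        by (rule power2_le_imp_le) (use uv rs in \<open>auto simp flip: uv\<close>)
      then have "u * (\<sigma> + \<tau>) \<le> r * s * (\<sigma> + \<tau>)"
        using st by (intro mult_right_mono) auto
      ultimately show ?thesis by linarith
    qed
    then have "0 \<le> Re S" by (simp add: ReS)
    moreover have "2 * sqrt (p - 1) * \<bar>Im S\<bar> \<le> (2 - p) * Re S"
      by (rule power2_le_imp_le[OF sq]) (use p \<open>0 \<le> Re S\<close> in auto)
    ultimately show ?thesis by simp
  qed
  then show "0 \<le> Re S" "2 * sqrt (p - 1) * \<bar>Im S\<bar> \<le> (2 - p) * Re S" by auto
qed

definition sector_angle :: "real \<Rightarrow> real" where
  "sector_angle p = arcsin (2 * sqrt (p - 1) / p)"

text \<open>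
  The sine and cosine identify \<open>sector_angle p\<close> with the complementary angle of the sector in
  \<open>dual_power_sector\<close>: its tangent is \<open>2 * sqrt (p - 1) / (2 - p)\<close>.
\<close>

lemma sector_angle:
  assumes "1 < p" "p < 2"
  shows "0 < sector_angle p" "sector_angle p < pi / 2"
    and "p * sin (sector_angle p) = 2 * sqrt (p - 1)" "p * cos (sector_angle p) = 2 - p"
proof -
  define y where "y = 2 * sqrt (p - 1) / p"
  have sq: "1 - y\<^sup>2 = ((2 - p) / p)\<^sup>2"
    using assms by (simp add: y_def power_divide power_mult_distrib field_simps)
      (simp add: power2_eq_square algebra_simps)
  moreover have "((2 - p) / p)\<^sup>2 > 0"
    using assms by simp
  ultimately have "\<bar>y\<bar> < 1"
    by (subst abs_square_less_1[symmetric]) linarith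
  then have y: "0 < y" "y < 1"
    using assms by (auto simp: y_def)
  have \<alpha>: "sector_angle p = arcsin y"
    by (simp add: sector_angle_def y_def)
  show "p * sin (sector_angle p) = 2 * sqrt (p - 1)"
    using assms y by (simp add: \<alpha>) (simp add: y_def)
  have "cos (sector_angle p) = sqrt (1 - y\<^sup>2)"
    unfolding \<alpha> using y by (intro cos_arcsin) auto
  also have "\<dots> = (2 - p) / p"
    unfolding sq using assms by simp
  finally show "p * cos (sector_angle p) = 2 - p"
    using assms by simp
  show "0 < sector_angle p" "sector_angle p < pi / 2"
    using arcsin_less_arcsin[of 0 y] arcsin_less_arcsin[of y 1] y by (auto simp: \<alpha>)
qed

lemma dual_power_accretive:
  fixes a b :: complex
  assumes p: "1 < p" "p < 2" and "\<bar>\<theta>\<bar> \<le> sector_angle p"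
  shows "0 \<le> Re (cis \<theta> * ((a - b) * cnj (dual_power p a - dual_power p b)))"
proof -
  define S where "S = (a - b) * cnj (dual_power p a - dual_power p b)"
  define \<alpha> where "\<alpha> = sector_angle p"
  have S: "0 \<le> Re S" "2 * sqrt (p - 1) * \<bar>Im S\<bar> \<le> (2 - p) * Re S"
    unfolding S_def by (rule dual_power_sector[OF p])+
  have \<alpha>: "\<bar>\<theta>\<bar> \<le> \<alpha>" "0 < \<alpha>" "\<alpha> < pi / 2"
    using sector_angle[OF p] assms by (auto simp: \<alpha>_def)
  have tilt: "sin \<alpha> * \<bar>Im S\<bar> \<le> cos \<alpha> * Re S"
  proof -
    have "p * (sin \<alpha> * \<bar>Im S\<bar>) \<le> p * (cos \<alpha> * Re S)"
      using S sector_angle[OF p] by (simp add: \<alpha>_def mult.assoc[symmetric])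
    then show ?thesis using p by simp
  qed
  have c: "cos \<alpha> \<le> cos \<theta>"
    using cos_monotone_0_pi_le[of "\<bar>\<theta>\<bar>" \<alpha>] \<alpha> by simp
  have s: "\<bar>sin \<theta>\<bar> \<le> sin \<alpha>"
  proof -
    have "\<bar>sin \<theta>\<bar> = sin \<bar>\<theta>\<bar>"
      using \<alpha> sin_ge_zero[of "\<bar>\<theta>\<bar>"] by (cases "\<theta> \<ge> 0") auto
    then show ?thesis
      using \<alpha> sin_monotone_2pi_le[of "\<bar>\<theta>\<bar>" \<alpha>] by simp
  qed
  have "sin \<theta> * Im S \<le> \<bar>sin \<theta>\<bar> * \<bar>Im S\<bar>"
    by (simp flip: abs_mult)
  also have "\<dots> \<le> sin \<alpha> * \<bar>Im S\<bar>"
    using s by (intro mult_right_mono) auto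
  also have "\<dots> \<le> cos \<theta> * Re S"
    using tilt c S(1) by (meson mult_right_mono order_trans)
  finally show ?thesis
    unfolding S_def[symmetric] by simp
qed

section \<open>Walsh analysis on the cube\<close>

text \<open>
  The coordinates are indexed by \<open>{1..n}\<close>; without this declaration the simplifier would rewrite the
  lower bound to \<open>Suc 0\<close>, and facts about \<open>{1..n}\<close> would no longer match.
\<close>

declare One_nat_def [simp del]


lemma sum_cube_flip:
  assumes "i \<in> {1..n}"
  shows "(\<Sum>x\<in>cube n. h (x(i := - x i))) = (\<Sum>x\<in>cube n. h x)"
  by (rule sum.reindex_bij_witness[where i = "\<lambda>x. x(i := - x i)" and j = "\<lambda>x. x(i := - x i)"])
     (use assms flip_in_cube in auto)

lemma cube_square: "x \<in> cube n \<Longrightarrow> i \<in> {1..n} \<Longrightarrow> x i * x i = 1"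
  unfolding cube_def by (drule PiE_mem) auto

lemma walsh_flip:
  assumes "finite A"
  shows "walsh A (x(i := - x i)) = (if i \<in> A then - walsh A x else walsh A x)"
proof (cases "i \<in> A")
  case True
  have "walsh A y = y i * walsh (A - {i}) y" for y
    unfolding walsh_def using assms True by (rule prod.remove)
  moreover have "walsh (A - {i}) (x(i := - x i)) = walsh (A - {i}) x"
    unfolding walsh_def by (intro prod.cong) auto
  ultimately show ?thesis using True by simp
next
  case False
  then show ?thesis unfolding walsh_def by (auto intro!: prod.cong)
qed

lemma walsh_orthogonal:
  assumes "A \<subseteq> {1..n}" "B \<subseteq> {1..n}"
  shows "(\<Sum>x\<in>cube n. walsh A x * walsh B x) = (if A = B then 2 ^ n else 0)"
proof (cases "A = B")
  case True
  have "walsh A x * walsh A x = 1" if "x \<in> cube n" for x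
    unfolding walsh_def prod.distrib[symmetric]
    using assms that by (intro prod.neutral ballI cube_square) auto
  then show ?thesis
    using True by (simp add: card_cube)
next
  case False
  have fin: "finite A" "finite B"
    using assms finite_subset by auto
  obtain i where i: "i \<in> {1..n}" "(i \<in> A) \<noteq> (i \<in> B)"
    using False assms by blast
  have "(\<Sum>x\<in>cube n. walsh A x * walsh B x) =
      (\<Sum>x\<in>cube n. walsh A (x(i := - x i)) * walsh B (x(i := - x i)))"
    by (rule sum_cube_flip[OF i(1), symmetric])
  also have "\<dots> = - (\<Sum>x\<in>cube n. walsh A x * walsh B x)"
    unfolding walsh_flip[OF fin(1)] walsh_flip[OF fin(2)] sum_negf[symmetric]
    using i(2) by (intro sum.cong) auto
  finally show ?thesis using False by simp
qed

text \<open>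
  Expanding the product over all subsets. The right-hand side vanishes at two distinct cube points and is
  nonnegative when \<open>x\<close> is a cube point and \<open>y\<close> lies in \<open>[-1, 1]^n\<close>; the first fact gives the Walsh
  expansion, the second the maximum principle for multilinear extensions.
\<close>

lemma walsh_kernel:
  "(\<Sum>A\<in>Pow {1..n}. walsh A x * walsh A y) = (\<Prod>i=1..n. 1 + x i * y i)"
proof -
  have "(\<Prod>i=1..n. x i * y i + 1) = (\<Sum>A\<in>Pow {1..n}. (\<Prod>i\<in>A. x i * y i) * (\<Prod>i\<in>{1..n} - A. 1))"
    by (rule prod_add) simp
  then show ?thesis
    by (simp add: walsh_def prod.distrib add.commute)
qed

lemma walsh_kernel_cube:
  assumes "x \<in> cube n" "y \<in> cube n"
  shows "(\<Sum>A\<in>Pow {1..n}. walsh A x * walsh A y) = (if x = y then 2 ^ n else 0)"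
proof (cases "x = y")
  case True
  then show ?thesis
    using assms cube_square[of y n] unfolding walsh_kernel by simp
next
  case False
  have "\<exists>i\<in>{1..n}. x i \<noteq> y i"
  proof (rule ccontr)
    assume "\<not> ?thesis"
    then have "x = y"
      using assms unfolding cube_def by (intro PiE_ext) auto
    then show False using False by simp
  qed
  then obtain i where i: "i \<in> {1..n}" "x i \<noteq> y i" by blast
  have "x i \<in> {-1, 1}" "y i \<in> {-1, 1}"
    using assms i(1) unfolding cube_def by (auto dest: PiE_mem)
  then have "1 + x i * y i = 0"
    using i(2) by auto
  then have "(\<Prod>i=1..n. 1 + x i * y i) = 0"
    using i(1) by (intro prod_zero) auto
  then show ?thesis
    using False by (simp add: walsh_kernel)
qed

lemma multilinear_extension_kernel:
  "(\<Sum>A\<in>Pow {1..n}. walsh_coeff n g A * of_real (walsh A y)) =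
   (\<Sum>x\<in>cube n. g x * of_real (\<Prod>i=1..n. 1 + x i * y i)) / 2 ^ n"
proof -
  have "(\<Sum>A\<in>Pow {1..n}. walsh_coeff n g A * of_real (walsh A y)) =
      (\<Sum>A\<in>Pow {1..n}. \<Sum>x\<in>cube n. g x * of_real (walsh A x * walsh A y)) / 2 ^ n"
    unfolding sum_divide_distrib walsh_coeff_def
    by (intro sum.cong refl) (simp add: sum_distrib_left sum_distrib_right sum_divide_distrib mult_ac)
  also have "(\<Sum>A\<in>Pow {1..n}. \<Sum>x\<in>cube n. g x * of_real (walsh A x * walsh A y)) =
      (\<Sum>x\<in>cube n. g x * of_real (\<Sum>A\<in>Pow {1..n}. walsh A x * walsh A y))"
    by (subst sum.swap) (simp add: sum_distrib_left)
  finally show ?thesis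
    unfolding walsh_kernel .
qed

lemma walsh_expansion:
  assumes "y \<in> cube n"
  shows "(\<Sum>A\<in>Pow {1..n}. walsh_coeff n g A * of_real (walsh A y)) = g y"
proof -
  have "(\<Sum>x\<in>cube n. g x * of_real (\<Prod>i=1..n. 1 + x i * y i)) =
      (\<Sum>x\<in>cube n. if x = y then 2 ^ n * g y else 0)"
    using walsh_kernel_cube[OF _ assms] unfolding walsh_kernel
    by (intro sum.cong) auto
  also have "\<dots> = 2 ^ n * g y"
    using assms finite_cube by simp
  finally show ?thesis
    by (simp add: multilinear_extension_kernel)
qed

lemma walsh_coeff_cong:
  "(\<And>x. x \<in> cube n \<Longrightarrow> g x = h x) \<Longrightarrow> walsh_coeff n g A = walsh_coeff n h A"
  unfolding walsh_coeff_def by simp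

lemma walsh_coeff_sum:
  assumes "A \<subseteq> {1..n}"
  shows "walsh_coeff n (\<lambda>x. \<Sum>B\<in>Pow {1..n}. a B * of_real (walsh B x)) A = a A"
proof -
  have "(\<Sum>x\<in>cube n. (\<Sum>B\<in>Pow {1..n}. a B * of_real (walsh B x)) * complex_of_real (walsh A x)) =
      (\<Sum>B\<in>Pow {1..n}. a B * of_real (\<Sum>x\<in>cube n. walsh B x * walsh A x))"
    unfolding sum_distrib_right of_real_sum sum_distrib_left
    by (subst sum.swap) (simp add: mult_ac)
  also have "\<dots> = (\<Sum>B\<in>Pow {1..n}. if B = A then 2 ^ n * a A else 0)"
    using walsh_orthogonal[OF _ assms] by (intro sum.cong) auto
  also have "\<dots> = 2 ^ n * a A"
    using assms by simp
  finally show ?thesis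
    by (simp add: walsh_coeff_def)
qed

text \<open>
  The Fourier multiplier whose symbol depends on \<open>A\<close> only through \<open>card A\<close>. The Laplacian, the heat
  flow at complex time and the noise operator are all of this form.
\<close>

definition radial :: "nat \<Rightarrow> (nat \<Rightarrow> complex) \<Rightarrow> ((nat \<Rightarrow> real) \<Rightarrow> complex) \<Rightarrow> (nat \<Rightarrow> real) \<Rightarrow> complex" where
  "radial n m g x = (\<Sum>A\<in>Pow {1..n}. m (card A) * walsh_coeff n g A * of_real (walsh A x))"

lemma walsh_coeff_radial:
  "A \<subseteq> {1..n} \<Longrightarrow> walsh_coeff n (radial n m g) A = m (card A) * walsh_coeff n g A"
  unfolding radial_def by (rule walsh_coeff_sum)

lemma radial_radial: "radial n m (radial n m' g) = radial n (\<lambda>k. m k * m' k) g"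
  by (rule ext) (simp add: radial_def[of n m] radial_def[of n "\<lambda>k. m k * m' k"] walsh_coeff_radial mult_ac)

lemma radial_one: "x \<in> cube n \<Longrightarrow> radial n (\<lambda>_. 1) g x = g x"
  by (simp add: radial_def walsh_expansion)

lemma cube_deriv_expansion:
  assumes "x \<in> cube n" "i \<in> {1..n}"
  shows "cube_deriv i g x =
    (\<Sum>A\<in>Pow {1..n}. (if i \<in> A then walsh_coeff n g A else 0) * of_real (walsh A x))"
proof -
  have "cube_deriv i g x =
      (\<Sum>A\<in>Pow {1..n}. walsh_coeff n g A * of_real ((walsh A x - walsh A (x(i := - x i))) / 2))"
    unfolding cube_deriv_def
    using walsh_expansion[OF assms(1), of g] walsh_expansion[OF flip_in_cube[OF assms], of g]
    by (simp add: algebra_simps sum_subtractf flip: sum_divide_distrib)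
  also have "\<dots> = (\<Sum>A\<in>Pow {1..n}. (if i \<in> A then walsh_coeff n g A else 0) * of_real (walsh A x))"
    by (intro sum.cong) (auto simp: walsh_flip finite_subset)
  finally show ?thesis .
qed

lemma walsh_coeff_cube_deriv:
  assumes "A \<subseteq> {1..n}" "i \<in> {1..n}"
  shows "walsh_coeff n (cube_deriv i g) A = (if i \<in> A then walsh_coeff n g A else 0)"
  using walsh_coeff_sum[OF assms(1), of "\<lambda>A. if i \<in> A then walsh_coeff n g A else 0"]
  by (subst walsh_coeff_cong[OF cube_deriv_expansion[OF _ assms(2)]])

lemma cube_deriv_radial:
  assumes "x \<in> cube n" "i \<in> {1..n}"
  shows "cube_deriv i (radial n m g) x = radial n m (cube_deriv i g) x"
  unfolding cube_deriv_expansion[OF assms] radial_def[of n m "cube_deriv i g"]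
  by (intro sum.cong) (auto simp: walsh_coeff_radial walsh_coeff_cube_deriv[OF _ assms(2)])

text \<open>
  Each coordinate derivative keeps the coefficients of the sets containing that coordinate, so a sum of
  derivatives over \<open>I\<close> counts \<open>A\<close> once for every element of \<open>A \<inter> I\<close>.
\<close>

lemma sum_over_members:
  fixes a :: "nat set \<Rightarrow> complex"
  assumes "finite I"
  shows "(\<Sum>i\<in>I. \<Sum>A\<in>Pow {1..n}. (if i \<in> A then a A else 0)) =
    (\<Sum>A\<in>Pow {1..n}. of_nat (card (A \<inter> I)) * a A)"
proof -
  have "(\<Sum>i\<in>I. if i \<in> A then a A else 0) = of_nat (card (A \<inter> I)) * a A" for A
  proof -
    have "I \<inter> {i. i \<in> A} = A \<inter> I"
      by auto
    then show ?thesis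
      using assms by (simp add: sum.If_cases)
  qed
  then show ?thesis by (subst sum.swap) simp
qed

lemma laplacian_radial:
  assumes "x \<in> cube n"
  shows "(\<Sum>i=1..n. cube_deriv i g x) = radial n of_nat g x"
proof -
  have "(\<Sum>i=1..n. cube_deriv i g x) =
      (\<Sum>i=1..n. \<Sum>A\<in>Pow {1..n}. if i \<in> A then walsh_coeff n g A * of_real (walsh A x) else 0)"
    using assms by (intro sum.cong) (auto simp: cube_deriv_expansion intro!: sum.cong)
  also have "\<dots> = (\<Sum>A\<in>Pow {1..n}. of_nat (card (A \<inter> {1..n})) * (walsh_coeff n g A * of_real (walsh A x)))"
    by (rule sum_over_members) simp
  also have "\<dots> = radial n of_nat g x"
    unfolding radial_def by (intro sum.cong) (auto simp: Int_absorb2)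
  finally show ?thesis .
qed

section \<open>Contractivity of the heat flow at complex times\<close>

text \<open>
  The \<open>p\<close>-th power of the \<open>L\<^sub>p\<close> norm, without the factor \<open>2 ^ n\<close>. Since contractivity is proved through
  Young's inequality, which is additive in \<open>p\<close>-th powers, roots and normalisations would only be in the way.
\<close>

definition energy :: "nat \<Rightarrow> real \<Rightarrow> ((nat \<Rightarrow> real) \<Rightarrow> complex) \<Rightarrow> real" where
  "energy n p g = (\<Sum>x\<in>cube n. cmod (g x) powr p)"

lemma energy_nonneg: "0 \<le> energy n p g"
  by (simp add: energy_def sum_nonneg)

lemma energy_cong: "(\<And>x. x \<in> cube n \<Longrightarrow> g x = h x) \<Longrightarrow> energy n p g = energy n p h"
  by (simp add: energy_def)

lemma dual_power_self: "a * cnj (dual_power p a) = of_real (cmod a powr p)"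
proof (cases "a = 0")
  case False
  have powr: "cmod a powr p = cmod a powr (p - 2) * (cmod a)\<^sup>2"
  proof -
    have "(cmod a)\<^sup>2 = cmod a powr 2"
      using False by simp
    then show ?thesis
      by (simp only: powr_add[symmetric]) simp
  qed
  have "a * cnj (dual_power p a) = of_real (cmod a powr (p - 2)) * (a * cnj a)"
    by (simp add: dual_power_def)
  also have "\<dots> = of_real (cmod a powr p)"
    unfolding powr using complex_norm_square[of a] by simp
  finally show ?thesis .
qed auto

lemma norm_dual_power: "p > 1 \<Longrightarrow> cmod (dual_power p a) = cmod a powr (p - 1)"
proof (cases "a = 0")
  case False
  have "cmod a powr (p - 1) = cmod a powr (p - 2) * cmod a powr 1"
    unfolding powr_add[symmetric] by simp
  then show ?thesis
    using False by (simp add: dual_power_def norm_mult)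
qed (auto simp: dual_power_def)

lemma dual_power_Young:
  assumes "p > 1"
  shows "cmod (u * cnj (dual_power p v)) \<le> cmod u powr p / p + (1 - 1 / p) * cmod v powr p"
proof -
  define q where "q = p / (p - 1)"
  have "cmod u * cmod v powr (p - 1) \<le> cmod u powr p / p + (cmod v powr (p - 1)) powr q / q"
    using assms by (intro Youngs_inequality) (auto simp: q_def field_simps)
  also have "(cmod v powr (p - 1)) powr q / q = (1 - 1 / p) * cmod v powr p"
  proof -
    have "(p - 1) * q = p" "1 / q = 1 - 1 / p"
      using assms by (simp_all add: q_def field_simps)
    then show ?thesis
      by (simp add: powr_powr divide_inverse mult.commute)
  qed
  finally show ?thesis
    using assms by (simp add: norm_mult norm_dual_power)
qed

text \<open>
  Holder's inequality for the conjugate exponents \<open>p\<close> and \<open>p / (p - 1)\<close>: both functions are normalised to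
  energy one, and Young's inequality is summed.
\<close>

lemma energy_Holder:
  assumes p: "p > 1"
  shows "cmod (\<Sum>x\<in>cube n. u x * cnj (dual_power p (v x)))
    \<le> energy n p u powr (1 / p) * energy n p v powr (1 - 1 / p)"
proof (cases "energy n p u = 0 \<or> energy n p v = 0")
  case True
  then have "(\<forall>x\<in>cube n. u x = 0) \<or> (\<forall>x\<in>cube n. v x = 0)"
    unfolding energy_def by (auto simp: sum_nonneg_eq_0_iff finite_cube)
  then have "(\<Sum>x\<in>cube n. u x * cnj (dual_power p (v x))) = 0"
    by (intro sum.neutral) (auto simp: dual_power_def)
  then show ?thesis
    by simp
next
  case False
  define a where "a = energy n p u powr (1 / p)"
  define b where "b = energy n p v powr (1 / p)"
  have E: "energy n p u > 0" "energy n p v > 0"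
    using False energy_nonneg by (auto simp: less_le)
  have ab: "a > 0" "b > 0" "a powr p = energy n p u" "b powr p = energy n p v"
    "b powr (p - 1) = energy n p v powr (1 - 1 / p)"
    using p E by (auto simp: a_def b_def powr_powr field_simps)
  have single: "cmod (u x * cnj (dual_power p (v x))) \<le> a * b powr (p - 1) *
      (cmod (u x) powr p / energy n p u / p + (1 - 1 / p) * (cmod (v x) powr p / energy n p v))" for x
  proof -
    have "cmod (u x) * cmod (v x) powr (p - 1) / (a * b powr (p - 1))
        = cmod (u x / of_real a * cnj (dual_power p (v x / of_real b)))"
      using p ab by (simp add: norm_mult norm_dual_power norm_divide powr_divide)
    also have "\<dots> \<le> cmod (u x / of_real a) powr p / p + (1 - 1 / p) * cmod (v x / of_real b) powr p"
      by (rule dual_power_Young[OF p])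
    also have "\<dots> = cmod (u x) powr p / energy n p u / p + (1 - 1 / p) * (cmod (v x) powr p / energy n p v)"
      using p ab by (simp add: norm_divide powr_divide)
    finally show ?thesis
      unfolding norm_mult complex_mod_cnj norm_dual_power[OF p]
      using ab(1,2) by (subst (asm) pos_divide_le_eq) (simp_all only: mult.commute mult_pos_pos powr_gt_zero)
  qed
  have "cmod (\<Sum>x\<in>cube n. u x * cnj (dual_power p (v x))) \<le> (\<Sum>x\<in>cube n. a * b powr (p - 1) *
      (cmod (u x) powr p / energy n p u / p + (1 - 1 / p) * (cmod (v x) powr p / energy n p v)))"
    by (rule sum_norm_le) (rule single)
  also have "\<dots> = a * b powr (p - 1) *
      (energy n p u / energy n p u / p + (1 - 1 / p) * (energy n p v / energy n p v))"
    by (simp only: sum_distrib_left[symmetric] sum.distrib sum_divide_distrib[symmetric] energy_def[symmetric])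
  also have "\<dots> = a * b powr (p - 1)"
    using E by simp
  finally show ?thesis
    by (simp add: ab a_def)
qed

text \<open>
  The \<open>i\<close>-th derivative changes sign under the flip of the \<open>i\<close>-th coordinate, so averaging the sum with
  its flipped version replaces \<open>dual_power p (g x)\<close> by half its difference across the edge. What remains is
  one two-point inequality for each edge in direction \<open>i\<close>.
\<close>

lemma cube_deriv_accretive:
  assumes p: "1 < p" "p < 2" and \<theta>: "\<bar>\<theta>\<bar> \<le> sector_angle p" and i: "i \<in> {1..n}"
  shows "0 \<le> Re (cis \<theta> * (\<Sum>x\<in>cube n. cube_deriv i g x * cnj (dual_power p (g x))))"
proof -
  let ?f = "\<lambda>x. x(i := - x i)"
  define T where "T = (\<Sum>x\<in>cube n. cube_deriv i g x * cnj (dual_power p (g x)))"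
  have "T = (\<Sum>x\<in>cube n. cube_deriv i g (?f x) * cnj (dual_power p (g (?f x))))"
    unfolding T_def by (rule sum_cube_flip[OF i, symmetric])
  also have "\<dots> = - (\<Sum>x\<in>cube n. cube_deriv i g x * cnj (dual_power p (g (?f x))))"
    unfolding sum_negf[symmetric] by (intro sum.cong) (auto simp: cube_deriv_def field_simps)
  finally have "4 * T = 2 * (\<Sum>x\<in>cube n. cube_deriv i g x * cnj (dual_power p (g x) - dual_power p (g (?f x))))"
    by (simp add: T_def right_diff_distrib sum_subtractf)
  also have "\<dots> = (\<Sum>x\<in>cube n. (g x - g (?f x)) * cnj (dual_power p (g x) - dual_power p (g (?f x))))"
    unfolding sum_distrib_left by (intro sum.cong) (auto simp: cube_deriv_def)
  finally have "cis \<theta> * (4 * T) = (\<Sum>x\<in>cube n.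
      cis \<theta> * ((g x - g (?f x)) * cnj (dual_power p (g x) - dual_power p (g (?f x)))))"
    by (simp only: sum_distrib_left)
  then have "Re (cis \<theta> * (4 * T)) =
      (\<Sum>x\<in>cube n. Re (cis \<theta> * ((g x - g (?f x)) * cnj (dual_power p (g x) - dual_power p (g (?f x))))))"
    by (simp only: Re_sum)
  also have "\<dots> \<ge> 0"
    by (intro sum_nonneg dual_power_accretive p \<theta>)
  finally have "0 \<le> 4 * Re (cis \<theta> * T)"
    by (simp add: algebra_simps)
  then show ?thesis
    unfolding T_def by linarith
qed

text \<open>
  Accretivity in norm form. Pairing \<open>g\<close> plus \<open>h * cis \<theta>\<close> times its Laplacian with the dual function of \<open>g\<close>
  gives at least the energy of \<open>g\<close>, and Young's inequality bounds the pairing by a convex combination of the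
  two energies. This passes from the infinitesimal statement to an inequality between norms without
  differentiating the norm.
\<close>

lemma energy_resolvent_step:
  assumes p: "1 < p" "p < 2" and \<theta>: "\<bar>\<theta>\<bar> \<le> sector_angle p" and "h \<ge> 0"
  shows "energy n p g \<le> energy n p (radial n (\<lambda>k. 1 + of_real h * cis \<theta> * of_nat k) g)"
proof -
  define G where "G = radial n (\<lambda>k. 1 + of_real h * cis \<theta> * of_nat k) g"
  have G: "G x = g x + of_real h * (cis \<theta> * (\<Sum>i=1..n. cube_deriv i g x))" if "x \<in> cube n" for x
  proof -
    have "G x = radial n (\<lambda>_. 1) g x + of_real h * (cis \<theta> * radial n of_nat g x)"
      by (simp add: G_def radial_def sum_distrib_left algebra_simps sum.distrib)
    then show ?thesis
      using that by (simp add: radial_one laplacian_radial)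
  qed
  have pairing: "(\<Sum>x\<in>cube n. G x * cnj (dual_power p (g x))) =
      of_real (energy n p g) + (\<Sum>i=1..n. of_real h *
        (cis \<theta> * (\<Sum>x\<in>cube n. cube_deriv i g x * cnj (dual_power p (g x)))))"
  proof -
    have "(\<Sum>x\<in>cube n. G x * cnj (dual_power p (g x))) =
        (\<Sum>x\<in>cube n. of_real (cmod (g x) powr p) +
          (\<Sum>i=1..n. of_real h * (cis \<theta> * (cube_deriv i g x * cnj (dual_power p (g x))))))"
      by (intro sum.cong) (simp_all add: G distrib_right dual_power_self, simp add: sum_distrib_left sum_distrib_right mult_ac)
    also have "\<dots> = of_real (energy n p g) + (\<Sum>i=1..n. \<Sum>x\<in>cube n. of_real h *
        (cis \<theta> * (cube_deriv i g x * cnj (dual_power p (g x)))))"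
      unfolding sum.distrib energy_def of_real_sum by (subst sum.swap) (rule refl)
    finally show ?thesis
      by (simp add: sum_distrib_left)
  qed
  have "energy n p g + (\<Sum>i=1..n. h * Re (cis \<theta> * (\<Sum>x\<in>cube n. cube_deriv i g x * cnj (dual_power p (g x)))))
      = Re (\<Sum>x\<in>cube n. G x * cnj (dual_power p (g x)))"
  proof -
    have "Re (of_real h * w) = h * Re w" for w
      by simp
    then show ?thesis
      unfolding pairing by (simp only: plus_complex.sel Re_sum Re_complex_of_real)
  qed
  moreover have "0 \<le> (\<Sum>i=1..n. h * Re (cis \<theta> * (\<Sum>x\<in>cube n. cube_deriv i g x * cnj (dual_power p (g x)))))"
    using \<open>h \<ge> 0\<close> by (intro sum_nonneg mult_nonneg_nonneg cube_deriv_accretive p \<theta>) auto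
  moreover have "Re (\<Sum>x\<in>cube n. G x * cnj (dual_power p (g x))) \<le> energy n p G / p + (1 - 1 / p) * energy n p g"
  proof -
    have "cmod (\<Sum>x\<in>cube n. G x * cnj (dual_power p (g x))) \<le>
        (\<Sum>x\<in>cube n. cmod (G x) powr p / p + (1 - 1 / p) * cmod (g x) powr p)"
      using p(1) by (intro sum_norm_le dual_power_Young)
    also have "\<dots> = energy n p G / p + (1 - 1 / p) * energy n p g"
      by (simp only: energy_def sum.distrib sum_divide_distrib sum_distrib_left)
    finally show ?thesis
      using complex_Re_le_cmod order_trans by blast
  qed
  ultimately have "energy n p g \<le> energy n p G / p + (1 - 1 / p) * energy n p g"
    by linarith
  then show ?thesis
    using p by (simp add: G_def field_simps)
qed

lemma tendsto_complex_exp_limit: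
  fixes z :: complex
  shows "(\<lambda>m. (1 + z / of_nat m) ^ m) \<longlonglongrightarrow> exp z"
proof (cases "z = 0")
  case False
  have "(Ln has_field_derivative 1) (at 1)"
    by (auto intro!: derivative_eq_intros)
  then have lim: "((\<lambda>h. Ln (1 + h) / h) \<longlongrightarrow> 1) (at 0)"
    by (simp add: DERIV_def)
  have "(\<lambda>m. z / of_nat m) \<longlonglongrightarrow> 0"
    by (rule lim_const_over_n)
  then have "filterlim (\<lambda>m. z / of_nat m) (at 0) sequentially"
    using False unfolding filterlim_at
    by (auto intro!: eventually_mono[OF eventually_gt_at_top[of 0]])
  from filterlim_compose[OF lim this]
  have "(\<lambda>m. exp (z * (Ln (1 + z / of_nat m) / (z / of_nat m)))) \<longlonglongrightarrow> exp (z * 1)"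
    by (intro tendsto_intros)
  moreover have "\<forall>\<^sub>F m in sequentially.
      exp (z * (Ln (1 + z / of_nat m) / (z / of_nat m))) = (1 + z / of_nat m) ^ m"
  proof -
    have "\<forall>\<^sub>F m in sequentially. dist (z / of_nat m) 0 < 1"
      using tendstoD[OF lim_const_over_n, of 1] by simp
    then show ?thesis
      using eventually_gt_at_top[of 0]
    proof eventually_elim
      case (elim m)
      have "1 + z / of_nat m \<noteq> 0"
      proof
        assume "1 + z / of_nat m = 0"
        then have "z / of_nat m = - 1"
          by (simp only: add_eq_0_iff)
        then show False
          using elim(1) by (simp only: dist_0_norm norm_minus_cancel) simp
      qed
      moreover have "z * (Ln (1 + z / of_nat m) / (z / of_nat m)) = of_nat m * Ln (1 + z / of_nat m)"
        using False elim by simp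
      ultimately show ?case
        by (simp add: exp_of_nat_mult)
    qed
  qed
  ultimately show ?thesis
    by (simp add: filterlim_cong)
qed simp

lemma energy_resolvent_iterate:
  assumes p: "1 < p" "p < 2" and \<theta>: "\<bar>\<theta>\<bar> \<le> sector_angle p" and "h \<ge> 0"
  shows "energy n p g \<le> energy n p (radial n (\<lambda>k. (1 + of_real h * cis \<theta> * of_nat k) ^ m) g)"
proof (induction m)
  case 0
  have "energy n p (radial n (\<lambda>k. 1) g) = energy n p g"
    by (rule energy_cong) (rule radial_one)
  then show ?case by simp
next
  case (Suc m)
  show ?case
    using Suc energy_resolvent_step[OF assms, of n "radial n (\<lambda>k. (1 + of_real h * cis \<theta> * of_nat k) ^ m) g"]
    by (simp add: radial_radial)
qed

text \<open>
  Euler's formula: the \<open>m\<close>-th power of one plus \<open>t / m\<close> times \<open>cis \<theta>\<close> times the Laplacian converges to the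
  inverse heat flow, coefficient by coefficient, and each of its \<open>m\<close> factors increases the energy.
\<close>

lemma energy_le_inverse_heat:
  assumes p: "1 < p" "p < 2" and \<theta>: "\<bar>\<theta>\<bar> \<le> sector_angle p" and "t \<ge> 0"
  shows "energy n p g \<le> energy n p (radial n (\<lambda>k. exp (of_real t * cis \<theta> * of_nat k)) g)"
proof (rule LIMSEQ_le_const)
  let ?m = "\<lambda>m k. (1 + of_real (t / real m) * cis \<theta> * of_nat k) ^ m"
  show "(\<lambda>m. energy n p (radial n (?m m) g)) \<longlonglongrightarrow>
      energy n p (radial n (\<lambda>k. exp (of_real t * cis \<theta> * of_nat k)) g)"
  proof -
    have "(\<lambda>m. ?m m k) \<longlonglongrightarrow> exp (of_real t * cis \<theta> * of_nat k)" for k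
      using tendsto_complex_exp_limit[of "of_real t * cis \<theta> * of_nat k"] by simp
    then show ?thesis
      unfolding energy_def radial_def using p by (intro tendsto_intros tendsto_powr') auto
  qed
  show "\<exists>N. \<forall>m\<ge>N. energy n p g \<le> energy n p (radial n (?m m) g)"
    using \<open>t \<ge> 0\<close> by (intro exI[of _ 0] allI impI energy_resolvent_iterate p \<theta>) auto
qed

text \<open>
  The heat flow contracts \<open>L\<^sub>p\<close> at all complex times in the sector of half-opening \<open>sector_angle p\<close>:
  \<open>energy_le_inverse_heat\<close> is applied to the evolved function.
\<close>

lemma heat_contraction:
  assumes p: "1 < p" "p < 2" and \<theta>: "\<bar>\<theta>\<bar> \<le> sector_angle p" and "t \<ge> 0"
  shows "energy n p (radial n (\<lambda>k. exp (- (of_real t * cis \<theta>) * of_nat k)) g) \<le> energy n p g"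
proof -
  let ?h = "radial n (\<lambda>k. exp (- (of_real t * cis \<theta>) * of_nat k)) g"
  have "energy n p ?h \<le> energy n p (radial n (\<lambda>k. exp (of_real t * cis \<theta> * of_nat k)) ?h)"
    by (rule energy_le_inverse_heat[OF assms])
  also have "radial n (\<lambda>k. exp (of_real t * cis \<theta> * of_nat k)) ?h = radial n (\<lambda>_. 1) g"
    by (simp add: radial_radial flip: exp_add)
  also have "energy n p \<dots> = energy n p g"
    by (rule energy_cong) (rule radial_one)
  finally show ?thesis .
qed

section \<open>The gradient after a small amount of noise\<close>

lemma cube_values: "x \<in> cube n \<Longrightarrow> i \<in> {1..n} \<Longrightarrow> x i = -1 \<or> x i = 1"
  unfolding cube_def by (drule PiE_mem) auto

lemma cmod_le_Linf_norm: "x \<in> cube n \<Longrightarrow> cmod (f x) \<le> Linf_norm n f"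
  unfolding Linf_norm_def by (intro Max_ge) (auto simp: finite_cube)

lemma cube_nonempty: "cube n \<noteq> {}"
proof
  assume "cube n = {}"
  then show False
    using card_cube[of n] by simp
qed

lemma Linf_norm_nonneg: "0 \<le> Linf_norm n f"
proof -
  obtain x where "x \<in> cube n"
    using cube_nonempty[of n] by blast
  then show ?thesis
    using order_trans[OF norm_ge_zero cmod_le_Linf_norm] by blast
qed

text \<open>
  The value of the multilinear extension at a point of \<open>[-1, 1]^n\<close> is an average of the values on the
  cube: the weights \<open>(\<Prod>i=1..n. 1 + x i * y i) / 2 ^ n\<close> are nonnegative and add up to one.
\<close>

lemma multilinear_extension_bound:
  assumes y: "\<And>i. i \<in> {1..n} \<Longrightarrow> \<bar>y i\<bar> \<le> 1"
  shows "cmod (\<Sum>A\<in>Pow {1..n}. walsh_coeff n f A * of_real (walsh A y)) \<le> Linf_norm n f"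
proof -
  define P where "P x = (\<Prod>i=1..n. 1 + x i * y i)" for x
  have P: "P x \<ge> 0" if "x \<in> cube n" for x
    unfolding P_def
  proof (rule prod_nonneg)
    fix i assume i: "i \<in> {1..n}"
    have "x i = -1 \<or> x i = 1"
      using that i by (rule cube_values)
    then show "0 \<le> 1 + x i * y i"
      using y[OF i] by auto
  qed
  have "(\<Sum>x\<in>cube n. P x) = (\<Sum>A\<in>Pow {1..n}. walsh A y * (\<Sum>x\<in>cube n. walsh A x * walsh {} x))"
    unfolding P_def walsh_kernel[symmetric]
    by (subst sum.swap) (simp add: sum_distrib_left walsh_def mult.commute)
  also have "\<dots> = (\<Sum>A\<in>Pow {1..n}. if A = {} then 2 ^ n else 0)"
    by (intro sum.cong) (auto simp: walsh_orthogonal, simp add: walsh_def)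
  also have "\<dots> = 2 ^ n"
    by simp
  finally have mass: "(\<Sum>x\<in>cube n. P x) = 2 ^ n" .
  have "cmod (\<Sum>x\<in>cube n. f x * of_real (P x)) \<le> (\<Sum>x\<in>cube n. Linf_norm n f * P x)"
    by (intro sum_norm_le) (auto simp: norm_mult P cmod_le_Linf_norm intro!: mult_right_mono)
  also have "\<dots> = Linf_norm n f * 2 ^ n"
    by (simp flip: sum_distrib_left add: mass)
  finally show ?thesis
    unfolding multilinear_extension_kernel P_def[symmetric]
    by (simp add: norm_divide norm_power field_simps)
qed

text \<open>
  Collecting coefficients by an integer statistic \<open>\<kappa>\<close> of the index set turns a Walsh sum into a
  polynomial in one variable. It is used with \<open>\<kappa> A = card (A \<inter> I)\<close> and with \<open>\<kappa> A = card A\<close>.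
\<close>

lemma sum_by_index:
  fixes X :: "nat set \<Rightarrow> complex" and \<kappa> :: "nat set \<Rightarrow> nat"
  assumes "\<And>A. A \<subseteq> {1..n} \<Longrightarrow> X A \<noteq> 0 \<Longrightarrow> \<kappa> A \<le> d"
  shows "(\<Sum>A\<in>Pow {1..n}. \<phi> (\<kappa> A) * X A) = (\<Sum>k\<le>d. \<phi> k * (\<Sum>A | A \<subseteq> {1..n} \<and> \<kappa> A = k. X A))"
proof -
  let ?S = "{A. A \<subseteq> {1..n} \<and> \<kappa> A \<le> d}"
  have "(\<Sum>A\<in>Pow {1..n}. \<phi> (\<kappa> A) * X A) = (\<Sum>A\<in>?S. \<phi> (\<kappa> A) * X A)"
    using assms by (intro sum.mono_neutral_right) auto
  also have "\<dots> = (\<Sum>k\<le>d. \<Sum>A\<in>{A \<in> ?S. \<kappa> A = k}. \<phi> (\<kappa> A) * X A)"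
    by (rule sum.group[symmetric]) auto
  also have "\<dots> = (\<Sum>k\<le>d. \<phi> k * (\<Sum>A | A \<subseteq> {1..n} \<and> \<kappa> A = k. X A))"
    unfolding sum_distrib_left by (intro sum.cong) auto
  finally show ?thesis .
qed

lemma degree_at_mostD:
  "degree_at_most n d f \<Longrightarrow> A \<subseteq> {1..n} \<Longrightarrow> walsh_coeff n f A \<noteq> 0 \<Longrightarrow> card A \<le> d"
  unfolding degree_at_most_def by (meson not_le)

text \<open>
  Scaling the coordinates of \<open>x\<close> in \<open>I\<close> by \<open>t\<close> and the other ones by \<open>\<rho>\<close> gives a polynomial of
  degree at most \<open>d\<close> in \<open>t\<close>, bounded on \<open>[-1, 1]\<close> by \<open>multilinear_extension_bound\<close>. The sum of derivatives
  is \<open>\<rho>\<close> times its derivative at \<open>t = \<rho>\<close>, an interior point, where Bernstein's inequality applies.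
  The noise thus improves Markov's \<open>d\<^sup>2\<close> at the endpoint to \<open>d / sqrt (1 - \<rho>\<^sup>2)\<close>.
\<close>

lemma noisy_partial_gradient:
  assumes deg: "degree_at_most n d f" and "d \<ge> 1" and \<rho>: "0 < \<rho>" "\<rho> < 1"
    and x: "x \<in> cube n" and I: "I \<subseteq> {1..n}"
  shows "cmod (\<Sum>i\<in>I. cube_deriv i (radial n (\<lambda>k. of_real (\<rho> ^ k)) f) x)
    \<le> exp 1 * real d * Linf_norm n f / sqrt (1 - \<rho>\<^sup>2)"
proof -
  have finI: "finite I"
    using I finite_subset by blast
  define X where "X A = walsh_coeff n f A * of_real (\<rho> ^ card (A - I)) * of_real (walsh A x)" for A
  define c where "c k = (\<Sum>A | A \<subseteq> {1..n} \<and> card (A \<inter> I) = k. X A)" for k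
  have X0: "card (A \<inter> I) \<le> d" if "A \<subseteq> {1..n}" "X A \<noteq> 0" for A
  proof -
    have "card A \<le> d"
      using that by (intro degree_at_mostD[OF deg]) (auto simp: X_def)
    moreover have "card (A \<inter> I) \<le> card A"
      using that finite_subset by (intro card_mono) auto
    ultimately show ?thesis by simp
  qed
  have group: "(\<Sum>A\<in>Pow {1..n}. \<phi> (card (A \<inter> I)) * X A) = (\<Sum>k\<le>d. \<phi> k * c k)" for \<phi>
    unfolding c_def by (rule sum_by_index) (rule X0)
  have bd: "cmod (\<Sum>k\<le>d. c k * of_real t ^ k) \<le> Linf_norm n f" if "\<bar>t\<bar> \<le> 1" for t :: real
  proof -
    define y where "y i = (if i \<in> I then t else \<rho>) * x i" for i
    have "walsh A y = t ^ card (A \<inter> I) * \<rho> ^ card (A - I) * walsh A x" if "A \<subseteq> {1..n}" for A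
    proof -
      have "finite A"
        using that finite_subset by blast
      then have "(\<Prod>i\<in>A. if i \<in> I then t else \<rho>) = t ^ card (A \<inter> I) * \<rho> ^ card (A - I)"
        by (subst prod.If_cases) (auto simp: Int_def set_diff_eq)
      then show ?thesis
        by (simp add: walsh_def y_def prod.distrib)
    qed
    then have "(\<Sum>k\<le>d. of_real t ^ k * c k) = (\<Sum>A\<in>Pow {1..n}. walsh_coeff n f A * of_real (walsh A y))"
      unfolding group[of "\<lambda>k. of_real t ^ k", symmetric] by (intro sum.cong) (auto simp: X_def mult_ac)
    moreover have "\<bar>y i\<bar> \<le> 1" if "i \<in> {1..n}" for i
    proof -
      have "x i = -1 \<or> x i = 1"
        using x that by (rule cube_values)
      then show ?thesis
        using \<open>\<bar>t\<bar> \<le> 1\<close> \<rho> by (auto simp: y_def)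
    qed
    ultimately show ?thesis
      using multilinear_extension_bound[of n y f] by (simp add: mult.commute)
  qed
  have "(\<Sum>i\<in>I. cube_deriv i (radial n (\<lambda>k. of_real (\<rho> ^ k)) f) x) =
      (\<Sum>i\<in>I. \<Sum>A\<in>Pow {1..n}. if i \<in> A then of_real (\<rho> ^ card A) * walsh_coeff n f A * of_real (walsh A x) else 0)"
  proof (intro sum.cong refl)
    fix i assume "i \<in> I"
    then have "i \<in> {1..n}" using I by auto
    then show "cube_deriv i (radial n (\<lambda>k. of_real (\<rho> ^ k)) f) x = (\<Sum>A\<in>Pow {1..n}.
        if i \<in> A then of_real (\<rho> ^ card A) * walsh_coeff n f A * of_real (walsh A x) else 0)"
      unfolding cube_deriv_expansion[OF x \<open>i \<in> {1..n}\<close>]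
      by (intro sum.cong) (auto simp: walsh_coeff_radial)
  qed
  also have "\<dots> = (\<Sum>A\<in>Pow {1..n}. of_nat (card (A \<inter> I)) * (of_real (\<rho> ^ card A) * walsh_coeff n f A * of_real (walsh A x)))"
    by (rule sum_over_members[OF finI])
  also have "\<dots> = (\<Sum>A\<in>Pow {1..n}. (of_nat (card (A \<inter> I)) * of_real \<rho> ^ card (A \<inter> I)) * X A)"
  proof (intro sum.cong refl)
    fix A assume "A \<in> Pow {1..n}"
    then have "finite A"
      using finite_subset by auto
    then have "card A = card (A \<inter> I) + card (A - I)"
      by (metis card_Int_Diff)
    then show "of_nat (card (A \<inter> I)) * (of_real (\<rho> ^ card A) * walsh_coeff n f A * of_real (walsh A x)) =
        (of_nat (card (A \<inter> I)) * of_real \<rho> ^ card (A \<inter> I)) * X A"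
      by (simp add: X_def power_add mult_ac)
  qed
  also have "\<dots> = of_real \<rho> * (\<Sum>k\<le>d. of_nat k * c k * of_real \<rho> ^ (k - 1))"
    unfolding group[of "\<lambda>k. of_nat k * of_real \<rho> ^ k"] sum_distrib_left
  proof (intro sum.cong refl)
    fix k
    show "of_nat k * of_real \<rho> ^ k * c k = of_real \<rho> * (of_nat k * c k * of_real \<rho> ^ (k - 1))"
      by (cases k) auto
  qed
  finally have "cmod (\<Sum>i\<in>I. cube_deriv i (radial n (\<lambda>k. of_real (\<rho> ^ k)) f) x) =
      \<rho> * cmod (\<Sum>k\<le>d. of_nat k * c k * of_real \<rho> ^ (k - 1))"
    using \<rho> by (simp add: norm_mult)
  also have "\<dots> \<le> cmod (\<Sum>k\<le>d. of_nat k * c k * of_real \<rho> ^ (k - 1))"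
    using \<rho> by (intro mult_left_le_one_le) auto
  also have "\<dots> \<le> exp 1 * real d * Linf_norm n f / sqrt (1 - \<rho>\<^sup>2)"
    using \<rho> by (intro bernstein_derivative[OF bd] \<open>d \<ge> 1\<close>) auto
  finally show ?thesis .
qed

text \<open>
  The real and the imaginary parts are each split by sign; this costs a factor \<open>4\<close> and reduces the
  \<open>\<ell>\<^sub>1\<close> norm of a complex vector to sums over subsets of its entries.
\<close>

lemma sum_norm_le_subset_sums:
  fixes a :: "'i \<Rightarrow> complex"
  assumes "finite J" and B: "\<And>I. I \<subseteq> J \<Longrightarrow> cmod (\<Sum>i\<in>I. a i) \<le> B"
  shows "(\<Sum>i\<in>J. cmod (a i)) \<le> 4 * B"
proof -
  have part: "(\<Sum>i\<in>J. \<bar>r i\<bar>) \<le> 2 * B" if r: "\<And>I. I \<subseteq> J \<Longrightarrow> \<bar>\<Sum>i\<in>I. r i\<bar> \<le> B" for r :: "'i \<Rightarrow> real"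
  proof -
    have "(\<Sum>i\<in>J. \<bar>r i\<bar>) = (\<Sum>i\<in>{i\<in>J. r i \<ge> 0}. \<bar>r i\<bar>) + (\<Sum>i\<in>{i\<in>J. \<not> r i \<ge> 0}. \<bar>r i\<bar>)"
      using \<open>finite J\<close> by (subst sum.union_disjoint[symmetric]) (auto intro!: sum.cong)
    also have "(\<Sum>i\<in>{i\<in>J. r i \<ge> 0}. \<bar>r i\<bar>) = (\<Sum>i\<in>{i\<in>J. r i \<ge> 0}. r i)"
      by (intro sum.cong) auto
    also have "(\<Sum>i\<in>{i\<in>J. \<not> r i \<ge> 0}. \<bar>r i\<bar>) = - (\<Sum>i\<in>{i\<in>J. \<not> r i \<ge> 0}. r i)"
      unfolding sum_negf[symmetric] by (intro sum.cong) auto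
    finally show ?thesis
      using r[of "{i\<in>J. r i \<ge> 0}"] r[of "{i\<in>J. \<not> r i \<ge> 0}"] by auto
  qed
  have "(\<Sum>i\<in>J. cmod (a i)) \<le> (\<Sum>i\<in>J. \<bar>Re (a i)\<bar> + \<bar>Im (a i)\<bar>)"
    by (intro sum_mono cmod_le)
  also have "\<dots> \<le> 2 * B + 2 * B"
    unfolding sum.distrib
  proof (intro add_mono part)
    fix I assume "I \<subseteq> J"
    then show "\<bar>\<Sum>i\<in>I. Re (a i)\<bar> \<le> B" "\<bar>\<Sum>i\<in>I. Im (a i)\<bar> \<le> B"
      using B[of I] abs_Re_le_cmod[of "\<Sum>i\<in>I. a i"] abs_Im_le_cmod[of "\<Sum>i\<in>I. a i"] by simp_all
  qed
  finally show ?thesis by simp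
qed

lemma parseval:
  "(\<Sum>x\<in>cube n. (cmod (g x))\<^sup>2) = 2 ^ n * (\<Sum>A\<in>Pow {1..n}. (cmod (walsh_coeff n g A))\<^sup>2)"
proof -
  have "complex_of_real (\<Sum>x\<in>cube n. (cmod (g x))\<^sup>2) = (\<Sum>x\<in>cube n. g x * cnj (g x))"
    by (simp only: of_real_sum complex_norm_square)
  also have "\<dots> = (\<Sum>x\<in>cube n. \<Sum>A\<in>Pow {1..n}. cnj (walsh_coeff n g A) * (g x * of_real (walsh A x)))"
  proof (intro sum.cong refl)
    fix x assume "x \<in> cube n"
    then have "cnj (g x) = (\<Sum>A\<in>Pow {1..n}. cnj (walsh_coeff n g A) * of_real (walsh A x))"
      by (subst walsh_expansion[symmetric]) auto
    then show "g x * cnj (g x) = (\<Sum>A\<in>Pow {1..n}. cnj (walsh_coeff n g A) * (g x * of_real (walsh A x)))"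
      by (simp add: sum_distrib_left mult_ac)
  qed
  also have "\<dots> = (\<Sum>A\<in>Pow {1..n}. cnj (walsh_coeff n g A) * (2 ^ n * walsh_coeff n g A))"
  proof -
    have "(\<Sum>x\<in>cube n. g x * of_real (walsh A x)) = 2 ^ n * walsh_coeff n g A" for A
      by (simp add: walsh_coeff_def)
    then show ?thesis
      by (subst sum.swap) (simp only: sum_distrib_left[symmetric])
  qed
  also have "\<dots> = 2 ^ n * (\<Sum>A\<in>Pow {1..n}. walsh_coeff n g A * cnj (walsh_coeff n g A))"
    by (simp add: sum_distrib_left mult_ac)
  also have "\<dots> = complex_of_real (2 ^ n * (\<Sum>A\<in>Pow {1..n}. (cmod (walsh_coeff n g A))\<^sup>2))"
    by (simp only: of_real_sum complex_norm_square of_real_mult) simp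
  finally show ?thesis
    by (simp only: of_real_eq_iff)
qed

text \<open>
  By Parseval a set \<open>A\<close> contributes its squared coefficient, damped by the noise, once for each of its at most
  \<open>d\<close> elements. This bound does not deteriorate as the noise tends to zero.
\<close>

lemma noisy_gradient_L2:
  assumes deg: "degree_at_most n d f" and \<rho>: "0 < \<rho>" "\<rho> < 1"
  shows "(\<Sum>i=1..n. \<Sum>x\<in>cube n. (cmod (cube_deriv i (radial n (\<lambda>k. of_real (\<rho> ^ k)) f) x))\<^sup>2)
    \<le> 2 ^ n * (real d * (Linf_norm n f)\<^sup>2)"
proof -
  let ?F = "radial n (\<lambda>k. of_real (\<rho> ^ k)) f"
  define b where "b A = (cmod (walsh_coeff n f A))\<^sup>2" for A
  have "(\<Sum>i=1..n. \<Sum>x\<in>cube n. (cmod (cube_deriv i ?F x))\<^sup>2) =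
      2 ^ n * (\<Sum>i=1..n. \<Sum>A\<in>Pow {1..n}. if i \<in> A then (\<rho> ^ card A)\<^sup>2 * b A else 0)"
    unfolding parseval sum_distrib_left[symmetric]
    using \<rho> by (intro arg_cong2[where f = "(*)"] refl sum.cong)
      (auto simp: walsh_coeff_cube_deriv walsh_coeff_radial norm_mult norm_power power_mult_distrib b_def)
  also have "(\<Sum>i=1..n. \<Sum>A\<in>Pow {1..n}. if i \<in> A then (\<rho> ^ card A)\<^sup>2 * b A else 0) =
      (\<Sum>A\<in>Pow {1..n}. real (card A) * ((\<rho> ^ card A)\<^sup>2 * b A))"
  proof (subst sum.swap, intro sum.cong refl)
    fix A assume "A \<in> Pow {1..n}"
    then have "{1..n} \<inter> {i. i \<in> A} = A"
      by auto
    then show "(\<Sum>i=1..n. if i \<in> A then (\<rho> ^ card A)\<^sup>2 * b A else 0) = real (card A) * ((\<rho> ^ card A)\<^sup>2 * b A)"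
      by (simp add: sum.If_cases)
  qed
  also have "2 ^ n * (\<Sum>A\<in>Pow {1..n}. real (card A) * ((\<rho> ^ card A)\<^sup>2 * b A))
      \<le> 2 ^ n * (\<Sum>A\<in>Pow {1..n}. real d * b A)"
  proof (intro mult_left_mono sum_mono)
    fix A assume A: "A \<in> Pow {1..n}"
    show "real (card A) * ((\<rho> ^ card A)\<^sup>2 * b A) \<le> real d * b A"
    proof (cases "walsh_coeff n f A = 0")
      case False
      have "real (card A) * (\<rho> ^ card A)\<^sup>2 \<le> real d * 1"
        using degree_at_mostD[OF deg _ False] A \<rho>
        by (intro mult_mono) (auto simp: power_le_one)
      then have "real (card A) * (\<rho> ^ card A)\<^sup>2 * b A \<le> real d * 1 * b A"
        by (rule mult_right_mono) (simp add: b_def)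
      then show ?thesis
        by (simp add: mult.assoc)
    qed (simp add: b_def)
  qed simp
  also have "2 ^ n * (\<Sum>A\<in>Pow {1..n}. real d * b A) = real d * (\<Sum>x\<in>cube n. (cmod (f x))\<^sup>2)"
    unfolding parseval by (simp add: b_def sum_distrib_left mult_ac)
  also have "\<dots> \<le> real d * (\<Sum>x\<in>cube n. (Linf_norm n f)\<^sup>2)"
    by (intro mult_left_mono sum_mono power_mono cmod_le_Linf_norm) auto
  also have "\<dots> = 2 ^ n * (real d * (Linf_norm n f)\<^sup>2)"
    by (simp add: card_cube)
  finally show ?thesis .
qed

text \<open>
  Interpolation between exponents one and two: the linear term dominates for \<open>a \<le> \<tau>\<close>, the quadratic one
  for \<open>a \<ge> \<tau>\<close>. The threshold \<open>\<tau>\<close> is free, to balance an \<open>L\<^sub>1\<close> against an \<open>L\<^sub>2\<close> bound.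
\<close>

lemma powr_le_linear_plus_square:
  fixes a \<tau> p :: real
  assumes "1 < p" "p < 2" "0 \<le> a" "0 < \<tau>"
  shows "a powr p \<le> \<tau> powr (p - 1) * (a + a\<^sup>2 / \<tau>)"
proof (cases "a = 0")
  case False
  define b where "b = a / \<tau>"
  have "b > 0"
    using False assms by (simp add: b_def)
  have "b powr p \<le> b + b\<^sup>2"
  proof (cases "b \<le> 1")
    case True
    have "b powr p \<le> b powr 1"
      using assms \<open>b > 0\<close> True by (intro powr_mono') auto
    then show ?thesis
      using \<open>b > 0\<close> by (smt (verit) powr_one zero_le_power2)
  next
    case False
    then have "b powr p \<le> b powr 2"
      using assms by (intro powr_mono) auto
    then show ?thesis
      using \<open>b > 0\<close> by simp
  qed
  then have "\<tau> powr p * b powr p \<le> \<tau> powr p * (b + b\<^sup>2)"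
    by (intro mult_left_mono) auto
  moreover have "\<tau> powr p * b powr p = a powr p"
    using assms by (simp add: b_def flip: powr_mult)
  moreover have "\<tau> powr p = \<tau> powr (p - 1) * \<tau>"
    using assms by (simp add: powr_diff)
  then have "\<tau> powr p * (b + b\<^sup>2) = \<tau> powr (p - 1) * (a + a\<^sup>2 / \<tau>)"
    using assms by (simp add: b_def field_simps power2_eq_square)
  ultimately show ?thesis by simp
qed (use assms in simp)

text \<open>
  The pointwise \<open>\<ell>\<^sub>1\<close> bound \<open>24 * d * M / sqrt \<delta>\<close> and the mean \<open>\<ell>\<^sub>2\<close> bound \<open>d * M\<^sup>2\<close>, with \<open>M\<close> the
  maximum of \<open>\<bar>f\<bar>\<close>, are interpolated at the threshold \<open>M * sqrt \<delta>\<close>, which balances them up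
  to a constant. Using the \<open>\<ell>\<^sub>2\<close> bound lowers the power of \<open>1 / \<delta>\<close> from \<open>1 / 2\<close> to \<open>(2 - p) / 2\<close>; the theorem draws on this gain.
\<close>

lemma noisy_influence:
  assumes p: "1 < p" "p < 2" and deg: "degree_at_most n d f" and "d \<ge> 1" and \<delta>: "0 < \<delta>" "\<delta> \<le> 1"
    and M: "Linf_norm n f > 0"
  shows "(\<Sum>i=1..n. energy n p (cube_deriv i (radial n (\<lambda>k. of_real (exp (- \<delta>) ^ k)) f)))
    \<le> 2 ^ n * (25 * real d * Linf_norm n f powr p * \<delta> powr ((p - 2) / 2))"
proof -
  define \<rho> where "\<rho> = exp (- \<delta>)"
  define M where "M = Linf_norm n f"
  define a where "a i x = cmod (cube_deriv i (radial n (\<lambda>k. of_real (\<rho> ^ k)) f) x)" for i x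
  define s where "s = sqrt \<delta>"
  define \<tau> where "\<tau> = M * s"
  have pos: "0 < M" "0 < s" "0 < \<tau>" and \<rho>: "0 < \<rho>" "\<rho> < 1"
    using assms by (auto simp: M_def s_def \<tau>_def \<rho>_def)
  have s_le: "s / 2 \<le> sqrt (1 - \<rho>\<^sup>2)"
  proof -
    have "\<rho>\<^sup>2 = inverse (exp (2 * \<delta>))"
      by (simp add: \<rho>_def exp_minus power_inverse flip: exp_of_nat_mult)
    also have "\<dots> \<le> inverse (1 + 2 * \<delta>)"
      using \<delta> exp_ge_add_one_self[of "2 * \<delta>"] by (intro le_imp_inverse_le) auto
    also have "\<dots> \<le> 1 - \<delta> / 4"
    proof -
      have "\<delta> * \<delta> \<le> \<delta>"
        using \<delta> by (simp add: mult_left_le)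
      then have "1 \<le> (1 - \<delta> / 4) * (1 + 2 * \<delta>)"
        using \<delta> by (simp add: algebra_simps)
      then show ?thesis
        using \<delta> by (simp add: field_simps)
    qed
    finally have "sqrt (\<delta> / 4) \<le> sqrt (1 - \<rho>\<^sup>2)"
      by (intro real_sqrt_le_mono) simp
    then show ?thesis
      by (simp add: s_def real_sqrt_divide)
  qed
  have L1: "(\<Sum>i=1..n. a i x) \<le> 24 * real d * M / s" if "x \<in> cube n" for x
  proof -
    have "(\<Sum>i=1..n. a i x) \<le> 4 * (exp 1 * real d * M / sqrt (1 - \<rho>\<^sup>2))"
      unfolding a_def M_def
      by (intro sum_norm_le_subset_sums noisy_partial_gradient deg \<open>d \<ge> 1\<close> \<rho> that) auto
    also have "\<dots> \<le> 4 * (3 * real d * M / (s / 2))"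
      using pos s_le exp_le by (intro mult_left_mono frac_le mult_right_mono mult_nonneg_nonneg) auto
    finally show ?thesis by simp
  qed
  have L2: "(\<Sum>x\<in>cube n. \<Sum>i=1..n. (a i x)\<^sup>2) \<le> 2 ^ n * (real d * M\<^sup>2)"
    unfolding a_def M_def by (subst sum.swap) (rule noisy_gradient_L2[OF deg \<rho>])
  have "(\<Sum>i=1..n. \<Sum>x\<in>cube n. a i x powr p) \<le> (\<Sum>i=1..n. \<Sum>x\<in>cube n. \<tau> powr (p - 1) * (a i x + (a i x)\<^sup>2 / \<tau>))"
    using p pos by (intro sum_mono powr_le_linear_plus_square) (auto simp: a_def)
  also have "\<dots> = \<tau> powr (p - 1) *
      ((\<Sum>x\<in>cube n. \<Sum>i=1..n. a i x) + (\<Sum>x\<in>cube n. \<Sum>i=1..n. (a i x)\<^sup>2) / \<tau>)"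
    by (subst sum.swap) (simp add: sum.distrib sum_divide_distrib flip: sum_distrib_left)
  also have "\<dots> \<le> \<tau> powr (p - 1) * ((\<Sum>x\<in>cube n. 24 * real d * M / s) + 2 ^ n * (real d * M\<^sup>2) / \<tau>)"
    using L1 L2 pos by (intro mult_left_mono add_mono divide_right_mono sum_mono) auto
  also have "\<dots> = 2 ^ n * (25 * real d * (\<tau> powr (p - 1) * (M / s)))"
    using pos by (simp add: card_cube \<tau>_def power2_eq_square field_simps)
  also have "\<tau> powr (p - 1) * (M / s) = M powr p * \<delta> powr ((p - 2) / 2)"
  proof -
    have "\<tau> powr (p - 1) * (M / s) = (M powr (p - 1) * M) * (s powr (p - 1) / s)"
      using pos by (simp add: \<tau>_def powr_mult)
    also have "M powr (p - 1) * M = M powr p"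
      using pos by (simp add: powr_diff)
    also have "s powr (p - 1) / s = s powr (p - 2)"
      using pos by (simp add: powr_diff power2_eq_square field_simps)
    also have "s powr (p - 2) = \<delta> powr ((p - 2) / 2)"
      using \<delta> by (simp add: s_def powr_powr field_simps flip: powr_half_sqrt)
    finally show ?thesis .
  qed
  finally show ?thesis
    by (simp add: energy_def a_def M_def \<rho>_def mult_ac)
qed

section \<open>Undoing the noise\<close>

text \<open>
  Noise of strength \<open>\<delta>\<close> can be undone on functions of degree at most \<open>d\<close>. Let \<open>u\<close> be the noisy function. The
  pairing of the heat flow of \<open>u\<close> at complex time \<open>z\<close> with the dual function of \<open>g\<close> is an exponential sum in
  \<open>z\<close> with exponents at most \<open>d\<close>. By \<open>heat_contraction\<close> and Holder's inequality it is at most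
  \<open>\<parallel>u\<parallel>\<^sub>p * \<parallel>g\<parallel>\<^sub>p powr (p - 1)\<close> in the sector (unnormalised norms), while at \<open>z = - \<delta>\<close> it equals
  \<open>\<parallel>g\<parallel>\<^sub>p powr p\<close>. So \<open>exponential_sum_extrapolation\<close> compares the two norms.
\<close>

lemma heat_extrapolation:
  assumes p: "1 < p" "p < 2" and deg: "degree_at_most n d g" and \<delta>: "0 < \<delta>" "\<delta> \<le> 1"
    and \<beta>: "0 < \<beta>" "\<beta> * (pi - sector_angle p) < pi / 2"
  shows "energy n p g \<le> exp (p * (4 * real d * \<delta> powr \<beta> / cos (\<beta> * (pi - sector_angle p))))
    * energy n p (radial n (\<lambda>k. exp (- of_real \<delta> * of_nat k)) g)"
proof -
  define u where "u = radial n (\<lambda>k. exp (- of_real \<delta> * of_nat k)) g"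
  define X where "X A = walsh_coeff n u A * (\<Sum>x\<in>cube n. of_real (walsh A x) * cnj (dual_power p (g x)))" for A
  define c where "c k = (\<Sum>A | A \<subseteq> {1..n} \<and> card A = k. X A)" for k
  define B where "B = energy n p u powr (1 / p) * energy n p g powr (1 - 1 / p)"
  define K where "K = 4 * real d * \<delta> powr \<beta> / cos (\<beta> * (pi - sector_angle p))"
  have pairing: "(\<Sum>x\<in>cube n. radial n m u x * cnj (dual_power p (g x))) = (\<Sum>k\<le>d. c k * m k)" for m
  proof -
    have "(\<Sum>x\<in>cube n. radial n m u x * cnj (dual_power p (g x))) = (\<Sum>A\<in>Pow {1..n}. m (card A) * X A)"
      unfolding radial_def X_def sum_distrib_left sum_distrib_right
      by (subst sum.swap) (simp add: mult_ac)
    also have "\<dots> = (\<Sum>k\<le>d. m k * c k)"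
      unfolding c_def
    proof (rule sum_by_index)
      fix A assume "A \<subseteq> {1..n}" "X A \<noteq> 0"
      then show "card A \<le> d"
        by (intro degree_at_mostD[OF deg]) (auto simp: X_def u_def walsh_coeff_radial)
    qed
    finally show ?thesis
      by (simp add: mult.commute)
  qed
  have "cmod (\<Sum>k\<le>d. c k * exp (of_real \<delta> * of_nat k)) \<le> B * exp K"
    unfolding K_def
  proof (rule exponential_sum_extrapolation)
    fix t \<theta> :: real assume t: "0 \<le> t" "\<bar>\<theta>\<bar> \<le> sector_angle p"
    let ?v = "radial n (\<lambda>k. exp (- (of_real t * cis \<theta>) * of_nat k)) u"
    have "cmod (\<Sum>k\<le>d. c k * exp (- (of_real t * cis \<theta>) * of_nat k))
        \<le> energy n p ?v powr (1 / p) * energy n p g powr (1 - 1 / p)"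
      unfolding pairing[symmetric] by (rule energy_Holder[OF p(1)])
    also have "\<dots> \<le> B"
      unfolding B_def using heat_contraction[OF p t(2,1)] p
      by (intro mult_right_mono powr_mono2) (auto simp: energy_nonneg)
    finally show "cmod (\<Sum>k\<le>d. c k * exp (- (of_real t * cis \<theta>) * of_nat k)) \<le> B" .
  qed (use sector_angle[OF p] \<beta> \<delta> in auto)
  moreover have "(\<Sum>k\<le>d. c k * exp (of_real \<delta> * of_nat k)) = of_real (energy n p g)"
  proof -
    have "(\<Sum>k\<le>d. c k * exp (of_real \<delta> * of_nat k)) =
        (\<Sum>x\<in>cube n. radial n (\<lambda>_. 1) g x * cnj (dual_power p (g x)))"
      unfolding pairing[symmetric] u_def by (simp add: radial_radial flip: exp_add)
    also have "\<dots> = of_real (energy n p g)"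
      by (simp add: radial_one dual_power_self energy_def)
    finally show ?thesis .
  qed
  ultimately have main: "energy n p g \<le> energy n p u powr (1 / p) * energy n p g powr (1 - 1 / p) * exp K"
    using energy_nonneg[of n p g] by (simp add: B_def)
  show ?thesis
  proof (cases "energy n p g = 0")
    case True
    then show ?thesis
      using energy_nonneg by simp
  next
    case False
    then have E: "energy n p g > 0"
      using energy_nonneg[of n p g] by simp
    have "energy n p g = energy n p g powr (1 / p) * energy n p g powr (1 - 1 / p)"
      using E by (simp flip: powr_add)
    then have "energy n p g powr (1 / p) * energy n p g powr (1 - 1 / p)
        \<le> (energy n p u powr (1 / p) * exp K) * energy n p g powr (1 - 1 / p)"
      using main by (simp add: mult_ac)
    then have "energy n p g powr (1 / p) \<le> energy n p u powr (1 / p) * exp K"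
      using E by simp
    then have "(energy n p g powr (1 / p)) powr p \<le> (energy n p u powr (1 / p) * exp K) powr p"
      using p by (intro powr_mono2) auto
    also have "\<dots> = energy n p u * exp (p * K)"
      using p energy_nonneg[of n p u] by (simp add: powr_mult powr_powr exp_powr_real mult.commute)
    finally show ?thesis
      using p E by (simp add: powr_powr K_def u_def mult.commute)
  qed
qed

section \<open>The influence bound\<close>

lemma Lp_influence_energy:
  assumes "p > 1"
  shows "Lp_influence n p f = (\<Sum>i=1..n. energy n p (cube_deriv i f)) / 2 ^ n"
  using assms energy_nonneg
  by (simp add: Lp_influence_def Lp_norm_def powr_powr sum_divide_distrib flip: energy_def)

lemma degree_at_most_cube_deriv:
  "degree_at_most n d f \<Longrightarrow> i \<in> {1..n} \<Longrightarrow> degree_at_most n d (cube_deriv i f)"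
  by (auto simp: degree_at_most_def walsh_coeff_cube_deriv)

theorem corollary16:
  fixes p :: real
  assumes "1 < p" and "p < 4 / 3"
  shows "\<exists>K::real. K > 0 \<and>
    (\<forall>(n::nat) (d::nat) (f::(nat \<Rightarrow> real) \<Rightarrow> complex).
      1 \<le> d \<and> d \<le> n \<and> degree_at_most n d f \<longrightarrow>
        Lp_influence n p f
          \<le> K * real d powr (2 - (1 / pi) * arcsin (2 * sqrt (p - 1) / p)) * Linf_norm n f powr p)"
proof -
  have p: "1 < p" "p < 2"
    using assms by auto
  define \<alpha> where "\<alpha> = sector_angle p"
  \<comment> \<open>The opening of the complementary sector, in units of \<open>pi\<close>.\<close>
  define \<kappa> where "\<kappa> = 2 * (pi - \<alpha>) / pi"
  \<comment> \<open>Chosen so that \<open>\<beta> * (pi - \<alpha>)\<close> is \<open>pi / 2\<close> shrunk by the factor \<open>2 - p < 1\<close>, and so that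
    \<open>\<delta> powr (- (2 - p) / 2)\<close> becomes \<open>d powr (\<kappa> / 2)\<close> for \<open>\<delta> = d powr (- 1 / \<beta>)\<close>.\<close>
  define \<beta> where "\<beta> = (2 - p) / \<kappa>"
  define co where "co = cos (\<beta> * (pi - \<alpha>))"
  have \<alpha>: "0 < \<alpha>" "\<alpha> < pi / 2"
    using sector_angle[OF p] by (auto simp: \<alpha>_def)
  then have "\<alpha> < pi"
    using pi_gt_zero by linarith
  then have \<kappa>: "\<kappa> > 0"
    by (simp add: \<kappa>_def)
  then have \<beta>: "\<beta> > 0"
    using p by (simp add: \<beta>_def)
  have ang: "\<beta> * (pi - \<alpha>) = (2 - p) * (pi / 2)"
  proof -
    have "(2 - p) / (2 * \<gamma> / pi) * \<gamma> = (2 - p) * (pi / 2)" if "\<gamma> > 0" for \<gamma>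
      using that by (simp add: field_simps)
    from this[of "pi - \<alpha>"] show ?thesis
      using \<open>\<alpha> < pi\<close> by (simp only: \<beta>_def \<kappa>_def diff_gt_0_iff_gt)
  qed
  then have ang2: "\<beta> * (pi - \<alpha>) < pi / 2"
    using p by simp
  define K where "K = exp (p * (4 / co)) * 25"
  have bound: "Lp_influence n p f \<le> K * real d powr (2 - (1 / pi) * \<alpha>) * Linf_norm n f powr p"
    if d: "1 \<le> d" and deg: "degree_at_most n d f" for n d and f :: "(nat \<Rightarrow> real) \<Rightarrow> complex"
  proof (cases "Linf_norm n f = 0")
    case True
    then have "f x = 0" if "x \<in> cube n" for x
      using cmod_le_Linf_norm[OF that, of f] by simp
    then have "cube_deriv i f x = 0" if "x \<in> cube n" "i \<in> {1..n}" for x i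
      unfolding cube_deriv_def using that flip_in_cube[OF that] by simp
    then have "energy n p (cube_deriv i f) = 0" if "i \<in> {1..n}" for i
      using that by (simp add: energy_def)
    then show ?thesis
      using True by (simp add: Lp_influence_energy[OF p(1)])
  next
    case False
    then have M: "Linf_norm n f > 0"
      using Linf_norm_nonneg[of n f] by simp
    \<comment> \<open>The largest power of \<open>d\<close> for which the factor in \<open>heat_extrapolation\<close> does not grow with \<open>d\<close>.\<close>
    define \<delta> where "\<delta> = real d powr (- 1 / \<beta>)"
    define T where "T = radial n (\<lambda>k. of_real (exp (- \<delta>) ^ k)) f"
    have \<delta>: "0 < \<delta>" "\<delta> \<le> 1"
    proof -
      show "0 < \<delta>" using d by (simp add: \<delta>_def)
      have "real d powr (- 1 / \<beta>) \<le> real d powr 0"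
        using d \<beta> by (intro powr_mono) auto
      then show "\<delta> \<le> 1" using d by (simp add: \<delta>_def)
    qed
    have d\<delta>: "real d * \<delta> powr \<beta> = 1"
    proof -
      have "- 1 / \<beta> * \<beta> = - 1"
        using \<beta> by simp
      then have "\<delta> powr \<beta> = real d powr - 1"
        by (simp only: \<delta>_def powr_powr)
      then show ?thesis
        using d by (simp add: powr_minus)
    qed
    have "energy n p (cube_deriv i f) \<le> exp (p * (4 / co)) * energy n p (cube_deriv i T)" if "i \<in> {1..n}" for i
    proof -
      have symbol: "exp (- of_real \<delta> * of_nat k) = complex_of_real (exp (- \<delta>) ^ k)" for k
        by (simp only: of_real_power exp_of_real[symmetric] exp_of_nat_mult[symmetric]) (simp add: mult.commute)
      have "energy n p (cube_deriv i f) \<le> exp (p * (4 * real d * \<delta> powr \<beta> / cos (\<beta> * (pi - sector_angle p))))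
          * energy n p (radial n (\<lambda>k. exp (- of_real \<delta> * of_nat k)) (cube_deriv i f))"
        using ang2 by (intro heat_extrapolation p degree_at_most_cube_deriv deg that \<delta> \<beta>) (simp add: \<alpha>_def)
      also have "energy n p (radial n (\<lambda>k. exp (- of_real \<delta> * of_nat k)) (cube_deriv i f)) = energy n p (cube_deriv i T)"
        unfolding symbol T_def by (intro energy_cong cube_deriv_radial[symmetric] that)
      also have "4 * real d * \<delta> powr \<beta> = 4"
        using d\<delta> by simp
      finally show ?thesis
        by (simp add: co_def \<alpha>_def)
    qed
    then have "(\<Sum>i=1..n. energy n p (cube_deriv i f)) \<le> exp (p * (4 / co)) * (\<Sum>i=1..n. energy n p (cube_deriv i T))"
      unfolding sum_distrib_left by (rule sum_mono)
    also have "\<dots> \<le> exp (p * (4 / co)) * (2 ^ n * (25 * real d * Linf_norm n f powr p * \<delta> powr ((p - 2) / 2)))"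
      unfolding T_def by (intro mult_left_mono noisy_influence p deg d \<delta> M) auto
    finally have "Lp_influence n p f \<le> K * (real d * \<delta> powr ((p - 2) / 2)) * Linf_norm n f powr p"
      unfolding Lp_influence_energy[OF p(1)] K_def by (simp add: field_simps)
    also have "real d * \<delta> powr ((p - 2) / 2) = real d powr (2 - (1 / pi) * \<alpha>)"
    proof -
      have "- 1 / \<beta> * ((p - 2) / 2) = 1 - \<alpha> / pi"
        using p \<open>\<alpha> < pi\<close> by (simp add: \<beta>_def \<kappa>_def field_simps)
      then have "real d * \<delta> powr ((p - 2) / 2) = real d powr 1 * real d powr (1 - \<alpha> / pi)"
        using d by (simp add: \<delta>_def powr_powr)
      also have "\<dots> = real d powr (1 + (1 - \<alpha> / pi))"
        by (rule powr_add[symmetric])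
      finally show ?thesis
        by simp
    qed
    finally show ?thesis .
  qed
  show ?thesis
  proof (intro exI[of _ K] conjI allI impI)
    show "0 < K" by (simp add: K_def)
  qed (use bound in \<open>auto simp: \<alpha>_def sector_angle_def\<close>)
qed

end
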